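(* Let $\lambda>0$. The average speed of any mean-field limit (MFL), with any initial state $f(0)\in\mathcal{M}$, is lower bounded by $v_{**}$.
   Context: Let $\lambda>0$ and let $Z>0$ be a random variable with CDF $J$ and $\mathbb{E}Z=1$. $\mathcal{M}$ is the set of (proper) cumulative distribution functions on $\mathbb{R}$. MFL. Consider $n$ particles on $\mathbb{R}$: each jumps forward by i.i.d. copies of $Z$ at the points of its own independent Poisson process of rate $\lambda$, and at the points of another independent Poisson process of rate $1$ chooses another particle uniformly at random and moves to its location if that is to the right. The MFL with initial state $f(0)\in\mathcal{M}$ is the deterministic $n\to\infty$ limit of the empirical distribution functions of particle locations when the initial ones converge weakly to $f(0)$; it coincides with the unique function $f_x(t)$ with that initial state such that (a) $f(t)\in\mathcal{M}$ for all $t$; (b) for every $x$, $f_x(t)$ is non-increasing and $(\lambda+1)$-Lipschitz in $t$; (c) for every $x$ and every $t$ at which the derivative exists, $$\frac{\partial}{\partial t}f_x(t)=-\lambda\int_{(-\infty,x]}(1-J(x-y))\,d_yf_y(t)-f_x(t)(1-f_x(t)).$$ Average speed. For $f\in\mathcal{M}$, $q_\nu(f)=\inf\{y:f_y\ge\nu\}$. The average speed of an MFL $f(\cdot)$ is lower bounded by $v$ if for every $\nu\in(0,1)$, $\liminf_{t\to\infty}\frac1t[q_\nu(f(t))-q_\nu(f(0))]\ge v$. Critical speed $v_{**}$. Let $L(s)=\int_0^\infty e^{-sx}\,dJ(x)$ and $\alpha=\sup\{\zeta\ge0:L(-\zeta)<\infty\}\in[0,\infty]$. If $\alpha>0$,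 let $$v(\zeta)=\frac1\zeta\,[\lambda L(-\zeta)-\lambda+1],\quad\zeta>0\quad(v(\zeta)=+\infty\text{ if }L(-\zeta)=\infty),\qquad v_{**}=\min_{\zeta>0}v(\zeta),$$ the minimum being attained at a unique point $\zeta_{**}\in(0,\alpha]$ with $\zeta_{**}<\infty$. If $\alpha=0$, by convention $v_{**}=+\infty$. *)

theory Defs
  imports "HOL-Probability.Probability"
begin

text \<open>
  Proper cumulative distribution functions on the real line, with the right-continuous
  convention \<open>cdf M x = measure M {..x}\<close>. For \<open>f\<close> in this set, \<open>interval_measure f\<close> is the
  probability measure with distribution function \<open>f\<close>, so that integration against
  \<open>interval_measure f\<close> is Lebesgue-Stieltjes integration against \<open>df\<close>.
\<close>

definition proper_cdfs :: "(real \<Rightarrow> real) set" where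
  "proper_cdfs = {cdf M | M. real_distribution M}"

definition quantile :: "real \<Rightarrow> (real \<Rightarrow> real) \<Rightarrow> real" where
  "quantile \<nu> f = Inf {y. f y \<ge> \<nu>}"

text \<open>
  \<open>f t x\<close> stands for \<open>f\<^sub>x(t)\<close>; time ranges over \<open>[0, \<infinity>)\<close> and the values of \<open>f\<close> at negative
  times are irrelevant. The mean-field limit is identified by its analytic characterization:
  for each initial state in \<open>proper_cdfs\<close> there is exactly one function on \<open>[0, \<infinity>)\<close> with these
  properties, and it is the limit of the empirical distribution functions of the particle
  system. At \<open>t = 0\<close> the derivative is one-sided.
\<close>

definition mean_field_limit ::
    "real \<Rightarrow> (real \<Rightarrow> real) \<Rightarrow> (real \<Rightarrow> real) \<Rightarrow> (real \<Rightarrow> real \<Rightarrow> real) \<Rightarrow> bool" where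
  "mean_field_limit lam J f0 f \<longleftrightarrow>
     f 0 = f0 \<and>
     (\<forall>t\<ge>0. f t \<in> proper_cdfs) \<and>
     (\<forall>x. antimono_on {0..} (\<lambda>t. f t x) \<and> (lam + 1)-lipschitz_on {0..} (\<lambda>t. f t x)) \<and>
     (\<forall>x. \<forall>t\<ge>0. \<forall>D. ((\<lambda>s. f s x) has_real_derivative D) (at t within {0..}) \<longrightarrow>
        D = - lam * (LINT y:{..x}|interval_measure (f t). (1 - J (x - y)))
            - f t x * (1 - f t x))"

definition avg_speed_lower_bounded :: "(real \<Rightarrow> real \<Rightarrow> real) \<Rightarrow> ereal \<Rightarrow> bool" where
  "avg_speed_lower_bounded f v \<longleftrightarrow>
     (\<forall>\<nu>\<in>{0<..<1}.
        Liminf at_top (\<lambda>t. ereal ((quantile \<nu> (f t) - quantile \<nu> (f 0)) / t)) \<ge> v)"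

definition laplace_transform :: "(real \<Rightarrow> real) \<Rightarrow> real \<Rightarrow> ennreal" where
  "laplace_transform J s = (\<integral>\<^sup>+x\<in>{0..}. ennreal (exp (- s * x)) \<partial>interval_measure J)"

definition abscissa :: "(real \<Rightarrow> real) \<Rightarrow> ereal" where
  "abscissa J = Sup {ereal \<zeta> | \<zeta>. \<zeta> \<ge> 0 \<and> laplace_transform J (- \<zeta>) < \<infinity>}"

definition speed_fun :: "real \<Rightarrow> (real \<Rightarrow> real) \<Rightarrow> real \<Rightarrow> ereal" where
  "speed_fun lam J \<zeta> =
     (if laplace_transform J (- \<zeta>) = \<infinity> then \<infinity>
      else ereal (1 / \<zeta> * (lam * enn2real (laplace_transform J (- \<zeta>)) - lam + 1)))"

text \<open>When \<open>abscissa J > 0\<close> the infimum below is attained, i.e. it is a minimum.\<close>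

definition critical_speed :: "real \<Rightarrow> (real \<Rightarrow> real) \<Rightarrow> ereal" where
  "critical_speed lam J = (if abscissa J > 0 then (INF \<zeta>\<in>{0<..}. speed_fun lam J \<zeta>) else \<infinity>)"

end

theory Submission
  imports Defs
begin

text \<open>
  Write \<open>u = 1 - f\<close> for the tail of the mean-field limit. Integrating out the particle location in
  the jump term turns the evolution equation into
  \<open>\<partial>u/\<partial>t = lam * (E u(x - Z) - u(x)) + u (1 - u)\<close>,
  an equation of Fisher-KPP type with nonlocal forward dispersal. The claim says that its front,
  started anywhere, eventually moves at least at the speed predicted by the linearization at
  \<open>u = 0\<close>. Fix a real \<open>v\<close> below the critical speed.

  \<^item> \<^emph>\<open>Truncation.\<close> Since \<open>u\<close> is nonincreasing in \<open>x\<close>, replacing \<open>Z\<close> by a bounded \<open>Y \<le> Z\<close> only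
    lowers the right-hand side. By monotone convergence and compactness a sufficiently high
    truncation level still satisfies \<open>v * \<zeta> < lam * (E exp(\<zeta>Y) - 1) + 1\<close> for all \<open>\<zeta> > 0\<close>
    (\<open>truncation_keeps_speed\<close>). The intermediate value theorem then yields a rate \<open>s \<ge> 0\<close> at which
    the group velocity \<open>lam * E(Y exp(sY))\<close> is at least \<open>v\<close> while the linearized equation still
    grows in the frame moving at that velocity (\<open>exists_decay_rate_of_speed\<close>).

  \<^item> \<^emph>\<open>Subsolution.\<close> Growth in the moving frame leaves room for a slow oscillation:
    \<open>exp(-s y) cos(\<gamma> y)\<close> with small \<open>\<gamma>\<close>, cut off to zero at its first zero on the right and continued
    to the left of its maximum by the constant maximal value \<open>\<epsilon>\<close>, is a travelling subsolution with
    a speed close to the group velocity (\<open>travelling_subsolution_exists\<close>).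

  \<^item> \<^emph>\<open>Comparison.\<close> A shift of the subsolution lies below \<open>u\<close> at time zero because \<open>u\<close> tends to one at
    minus infinity, and it stays below (\<open>travelling_subsolution_stays_below\<close>). So \<open>u \<ge> \<epsilon>\<close> on
    a half line whose end point moves with a speed above \<open>v\<close> (\<open>linear_spreading\<close>).

  \<^item> \<^emph>\<open>Saturation.\<close> Jumps go forward, so \<open>E u(x - Z) \<ge> u(x)\<close> and \<open>u\<close> grows at every fixed location at
    least logistically. After a bounded time the level \<open>\<epsilon>\<close> has risen above any level below one
    (\<open>logistic_decay\<close>), and a bounded delay does not affect the average speed.

  The equation is only given at the times where \<open>f\<close> happens to be differentiable. What makes it
  usable is that a Lipschitz function has enough such times to be controlled by its derivative
  there, even if a null set of times is discarded (\<open>Lipschitz_increment_le\<close>). This rests on Lebesgue's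
  differentiation theorem, proved here with Vitali's covering theorem.
\<close>


section \<open>Increments of Lipschitz functions\<close>

text \<open>
  Slopes are measured over intervals that contain the point anywhere, end points included. An
  interval is given by centre and radius so that it can serve in a Vitali covering.
\<close>

definition frequently_steeper :: "(real \<Rightarrow> real) \<Rightarrow> real \<Rightarrow> real \<Rightarrow> bool" where
  "frequently_steeper G q x \<longleftrightarrow>
     (\<forall>d>0. \<exists>a r. 0 < r \<and> r < d \<and> x \<in> cball a r \<and> q * (2 * r) < G (a + r) - G (a - r))"

definition frequently_flatter :: "(real \<Rightarrow> real) \<Rightarrow> real \<Rightarrow> real \<Rightarrow> bool" where
  "frequently_flatter G p x \<longleftrightarrow>
     (\<forall>d>0. \<exists>a r. 0 < r \<and> r < d \<and> x \<in> cball a r \<and> G (a + r) - G (a - r) < p * (2 * r))"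

lemma Vitali_covering_inside_open:
  fixes E U :: "real set"
  assumes "open U" "E \<subseteq> U"
    and fine: "\<And>x d. x \<in> E \<Longrightarrow> 0 < d \<Longrightarrow> \<exists>a r. 0 < r \<and> r < d \<and> x \<in> cball a r \<and> P a r"
  obtains C :: "(real \<times> real) set" where "countable C"
    "\<And>i. i \<in> C \<Longrightarrow> 0 < snd i \<and> P (fst i) (snd i) \<and> cball (fst i) (snd i) \<subseteq> U"
    "disjoint_family_on (\<lambda>i. cball (fst i) (snd i)) C"
    "negligible (E - (\<Union>i\<in>C. cball (fst i) (snd i)))"
proof -
  let ?K = "{i. 0 < snd i \<and> P (fst i) (snd i) \<and> cball (fst i) (snd i) \<subseteq> U}"
  have cov: "\<exists>i. i \<in> ?K \<and> x \<in> cball (fst i) (snd i) \<and> snd i < d" if "x \<in> E" "0 < d" for x d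
  proof -
    have "x \<in> U" using that assms by auto
    then obtain e where e: "0 < e" "cball x e \<subseteq> U"
      using \<open>open U\<close> open_contains_cball by blast
    obtain a r where ar: "0 < r" "r < min d (e/2)" "x \<in> cball a r" "P a r"
      using fine[OF \<open>x \<in> E\<close>, of "min d (e/2)"] \<open>0 < d\<close> e by auto
    have "cball a r \<subseteq> cball x e"
      using ar by (auto simp: dist_real_def)
    then have "(a, r) \<in> ?K" using ar e by auto
    then show ?thesis using ar by (intro exI[of _ "(a, r)"]) auto
  qed
  obtain C where C: "countable C" "C \<subseteq> ?K"
     "pairwise (\<lambda>i j. disjnt (cball (fst i) (snd i)) (cball (fst j) (snd j))) C"
     "negligible (E - (\<Union>i \<in> C. cball (fst i) (snd i)))"
    using Vitali_covering_theorem_cballs[of ?K snd E fst] cov by auto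
  show thesis
    by (rule that[of C]) (use C in \<open>auto simp: disjoint_family_on_def pairwise_def disjnt_def\<close>)
qed

text \<open>
  Vitali coverings exhaust a set only up to a null set; for a set that need not be measurable this
  lemma says that the exhausted part carries the whole outer measure.
\<close>

lemma outer_measure_le_Int:
  assumes "negligible (E - V)"
  shows "outer_measure_of lebesgue E \<le> outer_measure_of lebesgue (E \<inter> V)"
proof -
  obtain H where H: "H \<in> sets lebesgue" "E \<inter> V \<subseteq> H"
      "outer_measure_of lebesgue (E \<inter> V) = emeasure lebesgue H"
    using outer_measure_of_attain[of "E \<inter> V" lebesgue] by auto
  have N: "E - V \<in> null_sets lebesgue"
    using assms by (simp add: negligible_iff_null_sets)
  have "outer_measure_of lebesgue E \<le> outer_measure_of lebesgue (H \<union> (E - V))"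
    by (rule outer_measure_of_mono) (use H in auto)
  also have "\<dots> = emeasure lebesgue (H \<union> (E - V))"
    using H N by (intro outer_measure_of_eq) auto
  also have "\<dots> = emeasure lebesgue H"
    using H N by (intro emeasure_Un_null_set) auto
  finally show ?thesis using H by simp
qed

lemma cball_real_eq: "cball (a::real) r = {a - r..a + r}"
  by (auto simp: dist_real_def)

context
  fixes G :: "real \<Rightarrow> real"
  assumes G_mono: "\<And>x y. x \<le> y \<Longrightarrow> G x \<le> G y"
    and G_cont: "continuous_on UNIV G"
begin

lemma emeasure_interval_measure_cball:
  "0 < r \<Longrightarrow> emeasure (interval_measure G) (cball a r) = ennreal (G (a + r) - G (a - r))"
  unfolding cball_real_eq by (intro emeasure_interval_measure_Icc G_mono G_cont) auto

text \<open>
  The disjoint Vitali intervals fill \<open>E\<close> up to a null set, and on each of them \<open>G\<close> increases by more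
  than \<open>q\<close> times the length; their total increase is at most the Stieltjes mass of \<open>U\<close>.
\<close>

lemma outer_measure_steep_le:
  assumes "0 \<le> q" "open U" "E \<subseteq> U" and steep: "\<And>x. x \<in> E \<Longrightarrow> frequently_steeper G q x"
  shows "ennreal q * outer_measure_of lebesgue E \<le> emeasure (interval_measure G) U"
proof -
  let ?B = "\<lambda>i. cball (fst i) (snd i) :: real set"
  obtain C where C: "countable C"
    "\<And>i. i \<in> C \<Longrightarrow> 0 < snd i \<and> q * (2 * snd i) < G (fst i + snd i) - G (fst i - snd i) \<and> ?B i \<subseteq> U"
    "disjoint_family_on ?B C" "negligible (E - (\<Union>i\<in>C. ?B i))"
    by (rule Vitali_covering_inside_open[OF assms(2,3),
          of "\<lambda>a r. q * (2 * r) < G (a + r) - G (a - r)"])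
       (use steep in \<open>auto simp: frequently_steeper_def\<close>)
  have "outer_measure_of lebesgue E \<le> outer_measure_of lebesgue (E \<inter> (\<Union>i\<in>C. ?B i))"
    by (rule outer_measure_le_Int) (rule C)
  also have "\<dots> \<le> outer_measure_of lebesgue (\<Union>i\<in>C. ?B i)"
    by (rule outer_measure_of_mono) auto
  also have "\<dots> = emeasure lborel (\<Union>i\<in>C. ?B i)"
  proof -
    have "(\<Union>i\<in>C. ?B i) \<in> sets lborel"
      using C(1) by (auto intro!: sets.countable_UN')
    then show ?thesis by (simp add: outer_measure_of_eq del: sets_lborel)
  qed
  also have "\<dots> = (\<integral>\<^sup>+i. emeasure lborel (?B i) \<partial>count_space C)"
    using C by (intro emeasure_UN_countable) auto
  finally have "ennreal q * outer_measure_of lebesgue E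
      \<le> ennreal q * (\<integral>\<^sup>+i. emeasure lborel (?B i) \<partial>count_space C)"
    by (rule mult_left_mono) simp
  also have "\<dots> = (\<integral>\<^sup>+i. ennreal q * emeasure lborel (?B i) \<partial>count_space C)"
    by (rule nn_integral_cmult[symmetric]) simp
  also have "\<dots> \<le> (\<integral>\<^sup>+i. emeasure (interval_measure G) (?B i) \<partial>count_space C)"
  proof (rule nn_integral_mono)
    fix i assume "i \<in> space (count_space C)"
    then have i: "0 < snd i" "q * (2 * snd i) < G (fst i + snd i) - G (fst i - snd i)"
      using C(2)[of i] by auto
    show "ennreal q * emeasure lborel (?B i) \<le> emeasure (interval_measure G) (?B i)"
      unfolding emeasure_interval_measure_cball[OF i(1)] unfolding cball_real_eq
      using i \<open>0 \<le> q\<close> by (simp add: ennreal_mult[symmetric]) (intro ennreal_leI, linarith)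
  qed
  also have "\<dots> = emeasure (interval_measure G) (\<Union>i\<in>C. ?B i)"
    using C by (intro emeasure_UN_countable[symmetric]) auto
  also have "\<dots> \<le> emeasure (interval_measure G) U"
    using C \<open>open U\<close> by (intro emeasure_mono) auto
  finally show ?thesis .
qed

text \<open>
  The Vitali intervals with small slope, without their countably many end points, form the set
  \<open>V\<close>. Because it is open, steep intervals can afterwards be chosen inside it.
\<close>

lemma flat_cover:
  assumes "0 \<le> p" "open U" "E \<subseteq> U" and flat: "\<And>x. x \<in> E \<Longrightarrow> frequently_flatter G p x"
  obtains V where "open V" "negligible (E - V)"
    "emeasure (interval_measure G) V \<le> ennreal p * emeasure lborel U"
proof -
  let ?B = "\<lambda>i. cball (fst i) (snd i) :: real set"
  obtain C where C: "countable C"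
    "\<And>i. i \<in> C \<Longrightarrow> 0 < snd i \<and> G (fst i + snd i) - G (fst i - snd i) < p * (2 * snd i) \<and> ?B i \<subseteq> U"
    "disjoint_family_on ?B C" "negligible (E - (\<Union>i\<in>C. ?B i))"
    by (rule Vitali_covering_inside_open[OF assms(2,3),
          of "\<lambda>a r. G (a + r) - G (a - r) < p * (2 * r)"])
       (use flat in \<open>auto simp: frequently_flatter_def\<close>)
  let ?V = "\<Union>i\<in>C. ball (fst i) (snd i)"
  have "E - ?V \<subseteq> (E - (\<Union>i\<in>C. ?B i)) \<union> (\<Union>i\<in>C. {fst i - snd i, fst i + snd i})"
    by (fastforce simp: dist_real_def)
  moreover have "negligible (\<Union>i\<in>C. {fst i - snd i, fst i + snd i})"
    using C(1) unfolding negligible_iff_null_sets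
    by (intro null_sets_completionI countable_imp_null_set_lborel) auto
  ultimately have neg: "negligible (E - ?V)"
    using C(4) negligible_Un negligible_subset by blast
  have "emeasure (interval_measure G) ?V \<le> emeasure (interval_measure G) (\<Union>i\<in>C. ?B i)"
  proof (rule emeasure_mono)
    show "?V \<subseteq> (\<Union>i\<in>C. ?B i)" using ball_subset_cball by blast
    show "(\<Union>i\<in>C. ?B i) \<in> sets (interval_measure G)"
      using C(1) by (intro sets.countable_UN'') auto
  qed
  also have "\<dots> = (\<integral>\<^sup>+i. emeasure (interval_measure G) (?B i) \<partial>count_space C)"
    using C by (intro emeasure_UN_countable) auto
  also have "\<dots> \<le> (\<integral>\<^sup>+i. ennreal p * emeasure lborel (?B i) \<partial>count_space C)"
  proof (rule nn_integral_mono)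
    fix i assume "i \<in> space (count_space C)"
    then have i: "0 < snd i" "G (fst i + snd i) - G (fst i - snd i) < p * (2 * snd i)"
      using C(2)[of i] by auto
    show "emeasure (interval_measure G) (?B i) \<le> ennreal p * emeasure lborel (?B i)"
      unfolding emeasure_interval_measure_cball[OF i(1)] unfolding cball_real_eq
      using i \<open>0 \<le> p\<close> by (simp add: ennreal_mult[symmetric])
  qed
  also have "\<dots> = ennreal p * (\<integral>\<^sup>+i. emeasure lborel (?B i) \<partial>count_space C)"
    by (rule nn_integral_cmult) simp
  also have "\<dots> = ennreal p * emeasure lborel (\<Union>i\<in>C. ?B i)"
    using C by (subst emeasure_UN_countable) auto
  also have "\<dots> \<le> ennreal p * emeasure lborel U"
    using C \<open>open U\<close> by (intro mult_left_mono emeasure_mono) auto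
  finally show thesis
    using neg by (intro that[of ?V]) auto
qed

text \<open>
  Choose \<open>U \<supseteq> E\<close> of measure at most the outer measure \<open>m\<close> of \<open>E\<close> plus \<open>e\<close>. Flat intervals inside \<open>U\<close> give
  \<open>V\<close> of Stieltjes mass at most \<open>p (m + e)\<close>, steep intervals inside \<open>V\<close> show that this mass is at
  least \<open>q m\<close>. As \<open>p < q\<close> and \<open>e\<close> is arbitrary, \<open>m = 0\<close>.
\<close>

lemma negligible_flat_and_steep:
  assumes "bounded E" "0 \<le> p" "p < q"
    and flat: "\<And>x. x \<in> E \<Longrightarrow> frequently_flatter G p x"
    and steep: "\<And>x. x \<in> E \<Longrightarrow> frequently_steeper G q x"
  shows "negligible E"
proof -
  obtain H where H: "H \<in> sets lebesgue" "E \<subseteq> H" "outer_measure_of lebesgue E = emeasure lebesgue H"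
    using outer_measure_of_attain[of E lebesgue] by auto
  obtain R where R: "E \<subseteq> cball 0 R"
    using \<open>bounded E\<close> by (auto simp: bounded_iff subset_iff)
  have "outer_measure_of lebesgue E \<le> outer_measure_of lebesgue (cball (0::real) R)"
    by (rule outer_measure_of_mono) (rule R)
  also have "\<dots> < \<infinity>"
    using emeasure_lborel_cball_finite[of "0::real" R] by simp
  finally have fin: "emeasure lebesgue H < \<infinity>" using H by simp
  define m where "m = measure lebesgue H"
  have m: "emeasure lebesgue H = ennreal m" "0 \<le> m"
    unfolding m_def using fin by (simp_all add: emeasure_eq_ennreal_measure)
  have "q * m \<le> p * m + p * e" if "0 < e" for e
  proof -
    obtain U where U: "open U" "H \<subseteq> U" "(U - H) \<in> lmeasurable" "emeasure lebesgue (U - H) < ennreal e"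
      by (rule sets_lebesgue_outer_open[OF H(1) \<open>0 < e\<close>])
    have "emeasure lborel U = emeasure lebesgue (H \<union> (U - H))"
      using U by (simp add: Un_absorb1 Un_commute)
    also have "\<dots> \<le> emeasure lebesgue H + emeasure lebesgue (U - H)"
      using U H by (intro emeasure_subadditive) auto
    also have "\<dots> \<le> ennreal m + ennreal e"
      using U m by (intro add_mono) auto
    finally have lU: "emeasure lborel U \<le> ennreal (m + e)"
      using m \<open>0 < e\<close> by simp
    have "E \<subseteq> U" using H(2) U(2) by simp
    obtain V where V: "open V" "negligible (E - V)"
        "emeasure (interval_measure G) V \<le> ennreal p * emeasure lborel U"
      by (rule flat_cover[OF \<open>0 \<le> p\<close> U(1) \<open>E \<subseteq> U\<close> flat])
    have "ennreal q * ennreal m \<le> ennreal q * outer_measure_of lebesgue (E \<inter> V)"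
      using outer_measure_le_Int[OF V(2)] H m by (intro mult_left_mono) auto
    also have "\<dots> \<le> emeasure (interval_measure G) V"
      using assms steep by (intro outer_measure_steep_le V) auto
    also have "\<dots> \<le> ennreal p * ennreal (m + e)"
      using V(3) mult_left_mono[OF lU, of "ennreal p"] by auto
    finally have "ennreal (q * m) \<le> ennreal (p * (m + e))"
      using assms m(2) \<open>0 < e\<close> ennreal_mult[of q m] ennreal_mult[of p "m + e"] by simp
    moreover have "0 \<le> p * (m + e)" using assms m \<open>0 < e\<close> by simp
    ultimately have "q * m \<le> p * (m + e)" using ennreal_le_iff by blast
    then show ?thesis by (simp add: algebra_simps)
  qed
  then have *: "(q - p) * m \<le> p * e" if "0 < e" for e
    using that by (force simp: algebra_simps)
  have "m \<le> 0"
  proof (rule ccontr)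
    assume "\<not> m \<le> 0"
    then have pos: "0 < (q - p) * m" using \<open>p < q\<close> by simp
    have "0 < (q - p) * m / (p + 1)" using pos \<open>0 \<le> p\<close> by simp
    from *[OF this] have "(q - p) * m * (p + 1) \<le> p * ((q - p) * m)"
      using \<open>0 \<le> p\<close> by (simp add: pos_le_divide_eq)
    then have "(q - p) * m \<le> 0" by (simp add: distrib_left)
    then show False using pos by simp
  qed
  then have "H \<in> null_sets lebesgue" using H m by auto
  then show ?thesis
    using H(2) negligible_iff_null_sets negligible_subset by blast
qed

context
  fixes L :: real
  assumes G_Lip: "\<And>x y. x \<le> y \<Longrightarrow> G y - G x \<le> L * (y - x)" and L_nonneg: "0 \<le> L"
begin

lemma frequently_steeper_less:
  assumes "frequently_steeper G s x" shows "s < L"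
proof -
  obtain a r where "0 < r" "s * (2 * r) < G (a + r) - G (a - r)"
    using assms[unfolded frequently_steeper_def] zero_less_one by blast
  moreover have "G (a + r) - G (a - r) \<le> L * (2 * r)"
    using G_Lip[of "a - r" "a + r"] \<open>0 < r\<close> by simp
  ultimately have "s * (2 * r) < L * (2 * r)" by linarith
  then show ?thesis using \<open>0 < r\<close> by simp
qed

lemma frequently_steeper_mono:
  assumes "frequently_steeper G s x" "q \<le> s" shows "frequently_steeper G q x"
  unfolding frequently_steeper_def
proof (intro allI impI)
  fix d :: real assume "0 < d"
  then obtain a r where ar: "0 < r" "r < d" "x \<in> cball a r" "s * (2 * r) < G (a + r) - G (a - r)"
    using assms(1)[unfolded frequently_steeper_def] by blast
  moreover have "q * (2 * r) \<le> s * (2 * r)" using assms(2) ar by (intro mult_right_mono) auto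
  ultimately show "\<exists>a r. 0 < r \<and> r < d \<and> x \<in> cball a r \<and> q * (2 * r) < G (a + r) - G (a - r)"
    by (meson le_less_trans)
qed

text \<open>
  The derivative is the supremum \<open>D\<close> of the slopes that are exceeded on arbitrarily short intervals:
  no slope above \<open>D\<close> is exceeded frequently, and, since steep and flat intervals do not
  coexist for any pair of rational slopes, no slope below \<open>D\<close> is undercut frequently.
\<close>

lemma has_derivative_if_slopes_agree:
  assumes agree: "\<And>p q. p \<in> \<rat> \<Longrightarrow> q \<in> \<rat> \<Longrightarrow> 0 \<le> p \<Longrightarrow> p < q \<Longrightarrow>
                    \<not> (frequently_flatter G p x \<and> frequently_steeper G q x)"
  obtains D where "(G has_real_derivative D) (at x)" "\<And>q. D < q \<Longrightarrow> \<not> frequently_steeper G q x"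
proof -
  \<comment> \<open>Including the nonpositive slopes makes \<open>S\<close> nonempty and gives \<open>D \<ge> 0\<close>, as the criterion only
    covers nonnegative rationals.\<close>
  define S where "S = {s. s \<le> 0 \<or> frequently_steeper G s x}"
  define D where "D = Sup S"
  have bdd: "bdd_above S"
    unfolding S_def using frequently_steeper_less L_nonneg by (intro bdd_aboveI[of _ L]) force
  have S0: "0 \<in> S" by (simp add: S_def)
  have upper: "\<not> frequently_steeper G q x" if "D < q" for q
    using that cSup_upper[OF _ bdd, of q] by (auto simp: D_def S_def)
  have lower: "\<exists>d>0. \<forall>a r. 0 < r \<longrightarrow> r < d \<longrightarrow> x \<in> cball a r \<longrightarrow> s * (2 * r) \<le> G (a + r) - G (a - r)"
    if "s < D" for s
  proof (cases "s < 0")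
    case True
    have "s * (2 * r) \<le> G (a + r) - G (a - r)" if "0 < r" for a r
    proof -
      have "s * (2 * r) \<le> 0" using that True by (intro mult_nonpos_nonneg) auto
      then show ?thesis using G_mono[of "a - r" "a + r"] that by linarith
    qed
    then show ?thesis by (intro exI[of _ 1]) auto
  next
    case False
    have "S \<noteq> {}" using S0 by blast
    then obtain s' where s': "s' \<in> S" "s < s'"
      using less_cSupD[OF _ \<open>s < D\<close>[unfolded D_def]] by blast
    then have st: "frequently_steeper G s' x" using False by (auto simp: S_def)
    obtain p where p: "p \<in> \<rat>" "s < p" "p < s'" using Rats_dense_in_real s'(2) by blast
    obtain q where q: "q \<in> \<rat>" "p < q" "q < s'" using Rats_dense_in_real p(3) by blast
    have "frequently_steeper G q x" using frequently_steeper_mono[OF st] q by simp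
    then have "\<not> frequently_flatter G p x" using agree[OF p(1) q(1)] p q False by auto
    then obtain d where d: "0 < d" "\<And>a r. 0 < r \<Longrightarrow> r < d \<Longrightarrow> x \<in> cball a r \<Longrightarrow>
         p * (2 * r) \<le> G (a + r) - G (a - r)"
      unfolding frequently_flatter_def by (meson not_less)
    have "s * (2 * r) \<le> G (a + r) - G (a - r)" if "0 < r" "r < d" "x \<in> cball a r" for a r
    proof -
      have "s * (2 * r) \<le> p * (2 * r)" using p that by (intro mult_right_mono) auto
      then show ?thesis using d(2)[OF that] by linarith
    qed
    then show ?thesis using d(1) by blast
  qed
  have "(G has_real_derivative D) (at x)"
    unfolding has_field_derivative_iff
  proof (rule tendstoI)
    fix e :: real assume "0 < e"
    obtain d1 where d1: "0 < d1" "\<And>a r. 0 < r \<Longrightarrow> r < d1 \<Longrightarrow> x \<in> cball a r \<Longrightarrow>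
         (D - e/2) * (2 * r) \<le> G (a + r) - G (a - r)"
      using lower[of "D - e/2"] \<open>0 < e\<close> by auto
    have "\<not> frequently_steeper G (D + e/2) x" using upper \<open>0 < e\<close> by simp
    then obtain d2 where d2: "0 < d2" "\<And>a r. 0 < r \<Longrightarrow> r < d2 \<Longrightarrow> x \<in> cball a r \<Longrightarrow>
         G (a + r) - G (a - r) \<le> (D + e/2) * (2 * r)"
      unfolding frequently_steeper_def by (meson not_less)
    have main: "\<bar>(G y - G x) / (y - x) - D\<bar> < e" if y: "y \<noteq> x" "\<bar>y - x\<bar> < min d1 d2" for y
    proof -
      define a where "a = (x + y) / 2"
      define r where "r = \<bar>y - x\<bar> / 2"
      have r: "0 < r" "r < d1" "r < d2" "x \<in> cball a r"
        using y by (auto simp: r_def a_def dist_real_def)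
      have eq: "(G (a + r) - G (a - r)) / (2 * r) = (G y - G x) / (y - x)"
      proof (cases "x < y")
        case True
        then have "a + r = y" "a - r = x" "2 * r = y - x"
          by (auto simp: a_def r_def field_simps)
        then show ?thesis by (simp only:)
      next
        case False
        then have "a + r = x" "a - r = y" "2 * r = x - y"
          using y by (auto simp: a_def r_def field_simps)
        then show ?thesis using y by (simp only:) (simp add: field_simps)
      qed
      have "D - e/2 \<le> (G (a + r) - G (a - r)) / (2 * r)"
        using d1(2)[OF r(1,2,4)] r by (simp add: pos_le_divide_eq)
      moreover have "(G (a + r) - G (a - r)) / (2 * r) \<le> D + e/2"
        using d2(2)[OF r(1,3,4)] r by (simp add: pos_divide_le_eq)
      ultimately show ?thesis using \<open>0 < e\<close> unfolding eq by linarith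
    qed
    show "\<forall>\<^sub>F y in at x. dist ((G y - G x) / (y - x)) D < e"
      unfolding eventually_at
      using main d1(1) d2(1) by (intro exI[of _ "min d1 d2"]) (auto simp: dist_real_def)
  qed
  then show thesis using upper that by blast
qed

text \<open>
  Outside a null set \<open>E\<close> all short intervals around a point have slope at most any given \<open>q > K\<close>. Cover
  \<open>E\<close> by an open set \<open>W\<close> of small measure, and choose a gauge that keeps intervals tagged in
  \<open>E\<close> inside \<open>W\<close> and the others short. In a tagged division fine for this gauge the latter contribute at
  most \<open>q\<close> times their length and the former, by the Lipschitz bound, at most \<open>L\<close> times the measure of \<open>W\<close>.
\<close>

lemma monotone_Lipschitz_increment_le:
  assumes "a \<le> b" "negligible N" "0 \<le> K"
    and deriv: "\<And>x D. x \<in> {a<..<b} - N \<Longrightarrow> (G has_real_derivative D) (at x) \<Longrightarrow> D \<le> K"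
  shows "G b - G a \<le> K * (b - a)"
proof -
  define Bd where "Bd = (\<Union>i\<in>{i \<in> \<rat> \<times> \<rat>. 0 \<le> fst i \<and> fst i < snd i}.
     {x \<in> {a..b}. frequently_flatter G (fst i) x \<and> frequently_steeper G (snd i) x})"
  have "negligible Bd"
    unfolding Bd_def
  proof (rule negligible_countable_Union, goal_cases)
    case 1
    have "countable {i \<in> \<rat> \<times> \<rat>. 0 \<le> fst i \<and> fst i < (snd i::real)}"
      by (rule countable_subset[of _ "\<rat> \<times> \<rat>"]) (auto intro: countable_rat)
    then show ?case by (rule countable_image)
  next
    case (2 S)
    then obtain i where i: "0 \<le> fst i" "fst i < snd i"
      "S = {x \<in> {a..b}. frequently_flatter G (fst i) x \<and> frequently_steeper G (snd i) x}" by auto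
    show ?case
      by (rule negligible_flat_and_steep[OF _ i(1,2)])
         (use i in \<open>auto intro: bounded_subset[OF bounded_closed_interval[of a b]]\<close>)
  qed
  \<comment> \<open>The end points are added because nothing is known about derivatives there.\<close>
  define E where "E = Bd \<union> N \<union> {a, b}"
  have "negligible E"
    unfolding E_def using \<open>negligible Bd\<close> \<open>negligible N\<close> by (simp add: negligible_Un)
  have good: "\<not> frequently_steeper G q x" if "x \<in> {a..b}" "x \<notin> E" "K < q" for q x
  proof -
    have "\<not> (frequently_flatter G p x \<and> frequently_steeper G q x)"
      if "p \<in> \<rat>" "q \<in> \<rat>" "0 \<le> p" "p < q" for p q
      using that \<open>x \<in> {a..b}\<close> \<open>x \<notin> E\<close> by (force simp: E_def Bd_def)
    then obtain D where D: "(G has_real_derivative D) (at x)"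
        "\<And>q. D < q \<Longrightarrow> \<not> frequently_steeper G q x"
      using has_derivative_if_slopes_agree[of x] by blast
    have "D \<le> K" by (rule deriv[OF _ D(1)]) (use that in \<open>auto simp: E_def\<close>)
    then show ?thesis using D(2) that by simp
  qed
  have approx: "G b - G a \<le> q * (b - a) + L * e" if "K < q" "0 < e" for q e
  proof -
    obtain W where W: "open W" "E \<subseteq> W" "W \<in> lmeasurable" "measure lebesgue W < e"
    proof -
      have "E \<in> sets lebesgue" "emeasure lebesgue E = 0"
        using \<open>negligible E\<close> by (auto simp: negligible_iff_null_sets)
      moreover obtain W where W: "open W" "E \<subseteq> W" "W - E \<in> lmeasurable"
          "emeasure lebesgue (W - E) < ennreal e"
        by (rule sets_lebesgue_outer_open[OF \<open>E \<in> sets lebesgue\<close> \<open>0 < e\<close>])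
      moreover have "emeasure lebesgue W = emeasure lebesgue (W - E)"
        using W \<open>negligible E\<close> by (simp add: emeasure_Diff_null_set negligible_iff_null_sets)
      ultimately have "emeasure lebesgue W < ennreal e" by simp
      then have "W \<in> lmeasurable"
        using W(1) by (intro fmeasurableI) (auto intro: order.strict_trans)
      moreover have "measure lebesgue W < e"
        using \<open>emeasure lebesgue W < ennreal e\<close> emeasure_eq_measure2[OF \<open>W \<in> lmeasurable\<close>] \<open>0 < e\<close>
        by (simp add: ennreal_less_iff)
      ultimately show thesis using W that by blast
    qed
    have "\<exists>d>0. x \<in> {a..b} \<longrightarrow> x \<notin> E \<longrightarrow> (\<forall>c r. 0 < r \<longrightarrow> r < d \<longrightarrow> x \<in> cball c r \<longrightarrow>
         G (c + r) - G (c - r) \<le> q * (2 * r))" for x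
    proof (cases "x \<in> {a..b} \<and> x \<notin> E")
      case True
      then have "\<not> frequently_steeper G q x" using good \<open>K < q\<close> by blast
      then show ?thesis unfolding frequently_steeper_def by (meson not_less)
    next
      case False
      then show ?thesis by (intro exI[of _ 1]) auto
    qed
    then obtain d where d: "\<And>x. 0 < d x" "\<And>x c r. x \<in> {a..b} \<Longrightarrow> x \<notin> E \<Longrightarrow> 0 < r \<Longrightarrow> r < d x \<Longrightarrow>
         x \<in> cball c r \<Longrightarrow> G (c + r) - G (c - r) \<le> q * (2 * r)"
      by metis
    define \<gamma> where "\<gamma> = (\<lambda>x. if x \<in> E then W else ball x (d x))"
    have "gauge \<gamma>" unfolding gauge_def \<gamma>_def using W d(1) by auto
    obtain p where p: "p tagged_division_of {a..b}" "\<gamma> fine p"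
      by (rule fine_division_exists_real[OF \<open>gauge \<gamma>\<close>])
    have intW: "(indicat_real W) integrable_on S" if "S \<in> sets lebesgue" for S
    proof -
      have "W \<inter> S \<in> lmeasurable" using W(3) that by (rule fmeasurable_Int_fmeasurable)
      then have "indicat_real (W \<inter> S) integrable_on UNIV"
        by (simp add: integrable_on_indicator)
      moreover have "indicat_real (W \<inter> S) = (\<lambda>x. if x \<in> S then indicat_real W x else 0)"
        by (auto simp: indicator_def)
      ultimately show ?thesis
        using integrable_restrict_UNIV[of S "indicat_real W"] by simp
    qed
    \<comment> \<open>Both contributions are added for every interval, so that no case distinction is left in the sum;
      the second one is summed as an integral of the indicator of \<open>W\<close>.\<close>
    have term_le: "G (Sup k) - G (Inf k) \<le> q * measure lborel k + L * integral k (indicat_real W)"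
      if xk: "(x, k) \<in> p" for x k
    proof -
      obtain u v where k: "k = {u..v}" "u \<le> v" "x \<in> k" "k \<subseteq> {a..b}"
        using tagged_division_ofD(2,3,4)[OF p(1) xk] by (metis atLeastatMost_empty_iff2 box_real(2) empty_iff)
      have kg: "k \<subseteq> \<gamma> x" using p(2) xk by (auto simp: fine_def)
      have nonneg: "0 \<le> L * integral k (indicat_real W)" "0 \<le> q * measure lborel k"
        using L_nonneg \<open>K < q\<close> \<open>0 \<le> K\<close>
        by (auto intro!: mult_nonneg_nonneg integral_nonneg intW simp: k)
      show ?thesis
      proof (cases "x \<in> E")
        case True
        then have "k \<subseteq> W" using kg by (simp add: \<gamma>_def)
        then have "integral k (indicat_real W) = integral k (\<lambda>_. 1)"
          by (intro integral_cong) (auto simp: indicator_def)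
        then have "integral k (indicat_real W) = v - u" using k by simp
        then show ?thesis using G_Lip[OF k(2)] nonneg k by simp
      next
        case False
        show ?thesis
        proof (cases "u = v")
          case True
          then show ?thesis using k nonneg by simp
        next
          case ne: False
          have "u \<in> ball x (d x)" "v \<in> ball x (d x)" using kg k(1,2) False by (simp_all add: \<gamma>_def subset_iff)
          have mid: "(u+v)/2 + (v-u)/2 = v" "(u+v)/2 - (v-u)/2 = u"
            by (simp_all add: field_simps)
          have cb: "x \<in> cball ((u+v)/2) ((v-u)/2)"
            unfolding cball_real_eq mid using k by simp
          have "G ((u+v)/2 + (v-u)/2) - G ((u+v)/2 - (v-u)/2) \<le> q * (2 * ((v-u)/2))"
          proof (intro d(2)[of x])
            have "x - u < d x" "v - x < d x"
              using \<open>u \<in> ball x (d x)\<close> \<open>v \<in> ball x (d x)\<close> by (auto simp: dist_real_def)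
            then show "(v - u) / 2 < d x" by simp
            show "x \<in> {a..b}" using k(3,4) by blast
            show "0 < (v - u) / 2" using k(2) ne by simp
          qed (fact False cb)+
          then have "G v - G u \<le> q * (v - u)"
            by (simp add: field_simps)
          then show ?thesis using nonneg k by simp
        qed
      qed
    qed
    have "G b - G a = (\<Sum>(x,k)\<in>p. G (Sup k) - G (Inf k))"
      using additive_tagged_division_1[OF \<open>a \<le> b\<close> p(1), of G] by simp
    also have "\<dots> \<le> (\<Sum>(x,k)\<in>p. q * measure lborel k + L * integral k (indicat_real W))"
      by (rule sum_mono) (use term_le in auto)
    also have "\<dots> = q * (\<Sum>(x,k)\<in>p. measure lborel k) + L * (\<Sum>(x,k)\<in>p. integral k (indicat_real W))"
      by (simp add: case_prod_unfold sum.distrib sum_distrib_left)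
    also have "(\<Sum>(x,k)\<in>p. measure lborel k) = b - a"
      using additive_content_tagged_division[of p a b] p(1) \<open>a \<le> b\<close> by simp
    also have "(\<Sum>(x,k)\<in>p. integral k (indicat_real W)) = integral {a..b} (indicat_real W)"
      using integral_combine_tagged_division_topdown[of "indicat_real W" a b p] p(1) intW[of "{a..b}"] by simp
    also have "L * integral {a..b} (indicat_real W) \<le> L * e"
    proof (rule mult_left_mono[OF _ L_nonneg])
      have "integral {a..b} (indicat_real W) \<le> integral UNIV (indicat_real W)"
        by (rule integral_subset_le) (auto intro: intW)
      also have "\<dots> = measure lebesgue W" using W(3) by (simp add: lmeasure_integral_UNIV)
      finally show "integral {a..b} (indicat_real W) \<le> e" using W(4) by simp
    qed
    finally show ?thesis by simp
  qed
  have "G b - G a \<le> K * (b - a) + e" if "0 < e" for e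
  proof -
    define h where "h = e / (b - a + L + 1)"
    have h: "0 < h" using that \<open>a \<le> b\<close> L_nonneg by (simp add: h_def)
    have "G b - G a \<le> (K + h) * (b - a) + L * h" by (rule approx) (use h in auto)
    also have "\<dots> \<le> K * (b - a) + h * (b - a + L + 1)" using h by (simp add: algebra_simps)
    also have "h * (b - a + L + 1) = e" using \<open>a \<le> b\<close> L_nonneg by (simp add: h_def)
    finally show ?thesis .
  qed
  then show ?thesis by (rule field_le_epsilon)
qed

end

end

text \<open>
  A mean value inequality that needs the derivative only where it exists and only off a null set.
  Adding a steep linear function and extending beyond the interval by constants reduces it to
  nondecreasing functions on the whole line.
\<close>

theorem Lipschitz_increment_le:
  fixes g :: "real \<Rightarrow> real"
  assumes "a \<le> b" and Lip: "L-lipschitz_on {a..b} g" and "negligible N"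
    and deriv: "\<And>t D. t \<in> {a<..<b} - N \<Longrightarrow> (g has_real_derivative D) (at t) \<Longrightarrow> D \<le> K"
  shows "g b - g a \<le> K * (b - a)"
proof -
  \<comment> \<open>The slope \<open>L\<close> makes \<open>G\<close> nondecreasing, the extra \<open>\<bar>K\<bar>\<close> makes the bound \<open>K + M\<close> on its derivative
    nonnegative.\<close>
  define M where "M = L + \<bar>K\<bar>"
  define c where "c = (\<lambda>t. max a (min b t))"
  define G where "G = (\<lambda>t. g (c t) + M * t)"
  have "0 \<le> L" using Lip by (rule lipschitz_on_nonneg)
  have gc: "\<bar>g (c x) - g (c y)\<bar> \<le> L * (y - x)" if "x \<le> y" for x y
  proof -
    have "\<bar>g (c x) - g (c y)\<bar> \<le> L * \<bar>c x - c y\<bar>"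
      using lipschitz_onD[OF Lip, of "c x" "c y"] \<open>a \<le> b\<close> by (auto simp: c_def dist_real_def)
    also have "\<dots> \<le> L * (y - x)"
      using that \<open>0 \<le> L\<close> by (intro mult_left_mono) (auto simp: c_def)
    finally show ?thesis .
  qed
  have G_mono: "G x \<le> G y" if "x \<le> y" for x y
    using gc[OF that] mult_nonneg_nonneg[of "\<bar>K\<bar>" "y - x"] that
    by (simp add: G_def M_def algebra_simps)
  have G_Lip: "G y - G x \<le> (L + M) * (y - x)" if "x \<le> y" for x y
    using gc[OF that] by (simp add: G_def algebra_simps)
  have "(L + M)-lipschitz_on UNIV G"
  proof (rule lipschitz_onI)
    show "dist (G x) (G y) \<le> (L + M) * dist x y" for x y
      using G_Lip[of x y] G_Lip[of y x] G_mono[of x y] G_mono[of y x]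
      by (cases "x \<le> y") (auto simp: dist_real_def)
  qed (use \<open>0 \<le> L\<close> in \<open>simp add: M_def\<close>)
  then have "continuous_on UNIV G" by (rule lipschitz_on_continuous_on)
  have "G b - G a \<le> (K + M) * (b - a)"
  proof (rule monotone_Lipschitz_increment_le[OF G_mono \<open>continuous_on UNIV G\<close> G_Lip _ \<open>a \<le> b\<close> \<open>negligible N\<close>])
    fix x D assume x: "x \<in> {a<..<b} - N" and D: "(G has_real_derivative D) (at x)"
    have "((\<lambda>t. G t - M * t) has_real_derivative (D - M)) (at x)"
      using D by (auto intro!: derivative_eq_intros)
    then have "(g has_real_derivative (D - M)) (at x)"
      by (rule has_field_derivative_transform_within_open[of _ _ _ "{a<..<b}"])
         (use x in \<open>auto simp: G_def c_def\<close>)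
    then show "D \<le> K + M" using deriv[OF x] by force
  qed (use \<open>0 \<le> L\<close> in \<open>auto simp: M_def\<close>)
  then show ?thesis using \<open>a \<le> b\<close> by (simp add: G_def c_def algebra_simps)
qed

section \<open>The evolution equation as an expectation\<close>

lemma interval_measure_cdf:
  assumes "real_distribution M"
  shows "interval_measure (cdf M) = M"
proof -
  interpret real_distribution M by fact
  show ?thesis
  proof (rule cdf_unique)
    show "real_distribution (interval_measure (cdf M))"
      by (rule real_distribution_interval_measure)
         (auto intro: cdf_nondecreasing cdf_is_right_cont cdf_lim_at_bot cdf_lim_at_top_prob)
    show "cdf (interval_measure (cdf M)) = cdf M"
      by (rule cdf_interval_measure)
         (auto intro: cdf_nondecreasing cdf_is_right_cont cdf_lim_at_bot)
  qed fact
qed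

text \<open>
  By Fubini: for a particle at \<open>y\<close> distributed according to \<open>M\<close> and an independent jump \<open>Z\<close>, both sides are
  the probability that the jump carries the particle from \<open>{..x}\<close> to beyond \<open>x\<close>, conditioned
  on the particle on the left and on the jump on the right.
\<close>

lemma jump_integral_eq_expectation:
  assumes "real_distribution M" "prob_space \<Omega>" and Z[measurable]: "Z \<in> borel_measurable \<Omega>"
    and pos: "AE \<omega> in \<Omega>. Z \<omega> > 0" and J: "J = cdf (distr \<Omega> borel Z)"
  shows "(LINT y:{..x}|M. (1 - J (x - y))) = (\<integral>\<omega>. cdf M x - cdf M (x - Z \<omega>) \<partial>\<Omega>)"
proof -
  interpret M: real_distribution M by fact
  interpret P: prob_space \<Omega> by fact
  interpret PP: pair_prob_space M \<Omega> ..
  define h where "h = (\<lambda>y \<omega>. indicator {p. fst p \<le> x \<and> x < fst p + snd p} (y, Z \<omega>) :: real)"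
  have [measurable]: "case_prod h \<in> borel_measurable (M \<Otimes>\<^sub>M \<Omega>)"
    unfolding h_def by measurable
  have J1: "indicator {..x} y * (1 - J (x - y)) = (\<integral>\<omega>. h y \<omega> \<partial>\<Omega>)" for y
  proof (cases "y \<le> x")
    case True
    have "(\<integral>\<omega>. h y \<omega> \<partial>\<Omega>) = (\<integral>\<omega>. indicator {\<omega> \<in> space \<Omega>. x - y < Z \<omega>} \<omega> \<partial>\<Omega>)"
      by (rule Bochner_Integration.integral_cong) (use True in \<open>auto simp: h_def indicator_def\<close>)
    also have "\<dots> = P.prob {\<omega> \<in> space \<Omega>. x - y < Z \<omega>}" by simp
    also have "\<dots> = 1 - P.prob {\<omega> \<in> space \<Omega>. Z \<omega> \<le> x - y}"
      by (subst P.prob_compl[symmetric]) (auto intro!: arg_cong[where f=P.prob])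
    also have "P.prob {\<omega> \<in> space \<Omega>. Z \<omega> \<le> x - y} = J (x - y)"
      unfolding J cdf_def by (subst measure_distr) (auto intro!: arg_cong[where f=P.prob])
    finally show ?thesis using True by simp
  next
    case False
    then show ?thesis by (simp add: h_def)
  qed
  have "(LINT y:{..x}|M. (1 - J (x - y))) = (\<integral>y. (\<integral>\<omega>. h y \<omega> \<partial>\<Omega>) \<partial>M)"
    by (simp add: set_lebesgue_integral_def J1)
  also have "\<dots> = (\<integral>\<omega>. (\<integral>y. h y \<omega> \<partial>M) \<partial>\<Omega>)"
    by (rule PP.Fubini_integral[symmetric], rule PP.integrable_const_bound[of _ 1])
       (auto simp: h_def split_beta)
  also have "\<dots> = (\<integral>\<omega>. cdf M x - cdf M (x - Z \<omega>) \<partial>\<Omega>)"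
  proof (rule integral_cong_AE)
    show "AE \<omega> in \<Omega>. (\<integral>y. h y \<omega> \<partial>M) = cdf M x - cdf M (x - Z \<omega>)"
      using pos
    proof eventually_elim
      case (elim \<omega>)
      have "(\<integral>y. h y \<omega> \<partial>M) = (\<integral>y. indicator {x - Z \<omega><..x} y \<partial>M)"
        by (rule Bochner_Integration.integral_cong) (auto simp: h_def indicator_def)
      also have "\<dots> = measure M {x - Z \<omega><..x}" by simp
      also have "\<dots> = cdf M x - cdf M (x - Z \<omega>)"
        using elim by (intro M.cdf_diff_eq[symmetric]) simp
      finally show ?case .
    qed
    have [measurable]: "cdf M \<in> borel_measurable borel"
      by (rule borel_measurable_mono) (auto simp: mono_def M.cdf_nondecreasing)
    show "(\<lambda>\<omega>. cdf M x - cdf M (x - Z \<omega>)) \<in> borel_measurable \<Omega>" by measurable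
    show "(\<lambda>\<omega>. \<integral>y. h y \<omega> \<partial>M) \<in> borel_measurable \<Omega>" by measurable
  qed
  finally show ?thesis .
qed

text \<open>
  The first bound lets a jump \<open>Z\<close> be replaced by any shorter one, since a distribution function is
  nondecreasing; the second one drops the jumps altogether.
\<close>

lemma mean_field_limit_derivative_le:
  assumes "lam > 0" "prob_space \<Omega>" and Z[measurable]: "Z \<in> borel_measurable \<Omega>"
    and pos: "AE \<omega> in \<Omega>. Z \<omega> > 0" and J: "J = cdf (distr \<Omega> borel Z)"
    and mfl: "mean_field_limit lam J f0 f"
    and Y[measurable]: "Y \<in> borel_measurable \<Omega>"
    and Y0: "\<And>\<omega>. 0 \<le> Y \<omega>" and YZ: "AE \<omega> in \<Omega>. Y \<omega> \<le> Z \<omega>"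
    and "0 < t" and D: "((\<lambda>s. f s x) has_real_derivative D) (at t)"
  shows "D \<le> - lam * (\<integral>\<omega>. f t x - f t (x - Y \<omega>) \<partial>\<Omega>) - f t x * (1 - f t x)"
    and "D \<le> - f t x * (1 - f t x)"
proof -
  interpret P: prob_space \<Omega> by fact
  have "f t \<in> proper_cdfs" using mfl \<open>0 < t\<close> by (simp add: mean_field_limit_def)
  then obtain M where M: "real_distribution M" "f t = cdf M"
    by (auto simp: proper_cdfs_def)
  interpret M: real_distribution M by fact
  have [measurable]: "cdf M \<in> borel_measurable borel"
    by (rule borel_measurable_mono) (auto simp: mono_def M.cdf_nondecreasing)
  have int: "integrable \<Omega> (\<lambda>\<omega>. cdf M x - cdf M (x - X \<omega>))" if [measurable]: "X \<in> borel_measurable \<Omega>" for X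
    by (intro Bochner_Integration.integrable_diff P.integrable_const
          P.integrable_const_bound[of _ 1]) (auto simp: M.cdf_nonneg M.cdf_bounded_prob)
  have "((\<lambda>s. f s x) has_real_derivative D) (at t within {0..})"
    using D has_field_derivative_at_within by blast
  then have "D = - lam * (LINT y:{..x}|interval_measure (f t). (1 - J (x - y))) - f t x * (1 - f t x)"
    using mfl \<open>0 < t\<close> by (auto simp: mean_field_limit_def)
  then have D_eq: "D = - lam * (\<integral>\<omega>. cdf M x - cdf M (x - Z \<omega>) \<partial>\<Omega>) - f t x * (1 - f t x)"
    using jump_integral_eq_expectation[OF M(1) \<open>prob_space \<Omega>\<close> Z pos J, of x]
    by (simp add: M(2) interval_measure_cdf[OF M(1)])
  have le: "(\<integral>\<omega>. cdf M x - cdf M (x - Y \<omega>) \<partial>\<Omega>) \<le> (\<integral>\<omega>. cdf M x - cdf M (x - Z \<omega>) \<partial>\<Omega>)"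
    by (rule integral_mono_AE) (use YZ in \<open>auto intro!: int elim!: eventually_mono intro: M.cdf_nondecreasing\<close>)
  have nn: "0 \<le> (\<integral>\<omega>. cdf M x - cdf M (x - Y \<omega>) \<partial>\<Omega>)"
    by (rule Bochner_Integration.integral_nonneg) (simp add: M.cdf_nondecreasing Y0)
  show "D \<le> - lam * (\<integral>\<omega>. f t x - f t (x - Y \<omega>) \<partial>\<Omega>) - f t x * (1 - f t x)"
    using mult_left_mono[OF le, of lam] \<open>lam > 0\<close> unfolding D_eq M(2) by simp
  have "0 \<le> lam * (\<integral>\<omega>. cdf M x - cdf M (x - Z \<omega>) \<partial>\<Omega>)"
    using le nn \<open>lam > 0\<close> by simp
  then show "D \<le> - f t x * (1 - f t x)"
    unfolding D_eq by simp
qed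

lemma proper_cdfsD:
  assumes "g \<in> proper_cdfs"
  shows "0 \<le> g x" "g x \<le> 1" "mono g" "(g \<longlongrightarrow> 0) at_bot" "(g \<longlongrightarrow> 1) at_top"
proof -
  obtain M where M: "real_distribution M" and g: "g = cdf M"
    using assms by (auto simp: proper_cdfs_def)
  interpret real_distribution M by (rule M)
  show "0 \<le> g x" "g x \<le> 1" "mono g" "(g \<longlongrightarrow> 0) at_bot" "(g \<longlongrightarrow> 1) at_top"
    by (auto simp: g mono_def cdf_nonneg cdf_bounded_prob cdf_nondecreasing
        intro: cdf_lim_at_bot cdf_lim_at_top_prob)
qed

section \<open>Comparison with travelling subsolutions\<close>

text \<open>
  The profile \<open>w\<close> moves to the right at speed \<open>c\<close>. Only the places where it is positive matter, because a
  solution is nonnegative anyway. Two departures from smooth subsolutions are admitted. The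
  profile may lack a derivative at one point \<open>y0\<close>, which a given location meets at a single time. And
  where \<open>w' = 0\<close> no inequality is required, because at a location where the profile is
  stationary a nondecreasing solution cannot fall below it.
\<close>

definition travelling_subsolution ::
    "real \<Rightarrow> 'w measure \<Rightarrow> ('w \<Rightarrow> real) \<Rightarrow> real \<Rightarrow> (real \<Rightarrow> real) \<Rightarrow> bool" where
  "travelling_subsolution lam \<Omega> Y c w \<longleftrightarrow>
     (\<forall>y. 0 \<le> w y \<and> w y \<le> 1) \<and> (\<exists>L. L-lipschitz_on UNIV w) \<and>
     (\<exists>y0. \<forall>y. w y > 0 \<longrightarrow> y \<noteq> y0 \<longrightarrow> (\<exists>w'. (w has_real_derivative w') (at y) \<and>
        (w' = 0 \<or> - c * w' \<le> lam * (\<integral>\<omega>. w (y - Y \<omega>) - w y \<partial>\<Omega>) + w y * (1 - w y))))"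

context
  fixes lam :: real and \<Omega> :: "'w measure" and Y :: "'w \<Rightarrow> real" and f :: "real \<Rightarrow> real \<Rightarrow> real"
    and w :: "real \<Rightarrow> real" and c :: real
  assumes lam: "lam > 0" and "prob_space \<Omega>" and Y[measurable]: "Y \<in> borel_measurable \<Omega>"
    and f_bounds: "\<And>t x. 0 \<le> t \<Longrightarrow> 0 \<le> f t x \<and> f t x \<le> 1"
    and f_mono: "\<And>t. 0 \<le> t \<Longrightarrow> mono (f t)"
    and f_Lip: "\<And>x. (lam + 1)-lipschitz_on {0..} (\<lambda>t. f t x)"
    and f_deriv: "\<And>t x D. 0 < t \<Longrightarrow> ((\<lambda>s. f s x) has_real_derivative D) (at t) \<Longrightarrow>
        D \<le> - lam * (\<integral>\<omega>. f t x - f t (x - Y \<omega>) \<partial>\<Omega>) - f t x * (1 - f t x)"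
    and f_deriv_nonpos: "\<And>t x D. 0 < t \<Longrightarrow> ((\<lambda>s. f s x) has_real_derivative D) (at t) \<Longrightarrow> D \<le> 0"
    and c: "c > 0"
    and w: "travelling_subsolution lam \<Omega> Y c w"
begin

interpretation P: prob_space \<Omega> by fact

lemma profile_bounds: "0 \<le> w y \<and> w y \<le> 1"
  using w by (simp add: travelling_subsolution_def)

text \<open>
  The heart of the comparison principle. Let \<open>d\<close> be the excess of the travelling profile over the tail
  \<open>1 - f\<close>, with \<open>d \<le> 0\<close> at the beginning \<open>t0\<close> of a time strip and \<open>d \<le> D\<close> throughout it. At a
  fixed location, go back to the last time \<open>t1\<close> with \<open>d \<le> 0\<close>. Since then \<open>d > 0\<close>, so the profile is
  positive and satisfies its inequality, and subtracting the equation bounds the growth rate of \<open>d\<close> by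
  \<open>(lam + 1) D\<close>. The strip is so short that this yields at most \<open>D / 2\<close>.
\<close>

lemma excess_halves:
  fixes t0 D :: real
  defines "d \<equiv> \<lambda>t x. w (x - c * t) + f t x - 1"
  assumes "0 \<le> t0" "\<And>x. d t0 x \<le> 0"
    and dD: "\<And>t x. t0 \<le> t \<Longrightarrow> t \<le> t0 + 1 / (2 * (lam + 1)) \<Longrightarrow> d t x \<le> D" and "0 \<le> D"
    and t: "t0 \<le> t" "t \<le> t0 + 1 / (2 * (lam + 1))"
  shows "d t x \<le> D / 2"
proof (cases "d t x \<le> 0")
  case True
  then show ?thesis using \<open>0 \<le> D\<close> by simp
next
  case False
  obtain L y0 where w_Lip: "L-lipschitz_on UNIV w"
    and w_sub: "\<And>y. w y > 0 \<Longrightarrow> y \<noteq> y0 \<Longrightarrow> \<exists>w'. (w has_real_derivative w') (at y) \<and>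
        (w' = 0 \<or> - c * w' \<le> lam * (\<integral>\<omega>. w (y - Y \<omega>) - w y \<partial>\<Omega>) + w y * (1 - w y))"
    using w unfolding travelling_subsolution_def by metis
  have w_comp: "(L * c)-lipschitz_on UNIV (\<lambda>t. w (x - c * t))"
  proof (rule lipschitz_onI)
    show "dist (w (x - c * s)) (w (x - c * t)) \<le> L * c * dist s t" for s t
    proof -
      have "dist (w (x - c * s)) (w (x - c * t)) \<le> L * dist (x - c * s) (x - c * t)"
        by (rule lipschitz_onD[OF w_Lip]) auto
      also have "dist (x - c * s) (x - c * t) = c * dist s t"
        using c by (simp add: dist_real_def abs_mult flip: right_diff_distrib)
      finally show ?thesis by simp
    qed
  qed (use c lipschitz_on_nonneg[OF w_Lip] in auto)
  have d_Lip: "(L * c + (lam + 1))-lipschitz_on {0..} (\<lambda>t. d t x)"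
  proof (rule lipschitz_onI)
    fix s t :: real assume "s \<in> {0..}" "t \<in> {0..}"
    then show "dist (d s x) (d t x) \<le> (L * c + (lam + 1)) * dist s t"
      using lipschitz_onD[OF w_comp, of s t] lipschitz_onD[OF f_Lip, of s t x]
      by (simp add: d_def dist_real_def algebra_simps)
  qed (use c lam lipschitz_on_nonneg[OF w_Lip] in auto)
  then have d_cont: "continuous_on {0..} (\<lambda>t. d t x)" by (rule lipschitz_on_continuous_on)
  define S where "S = {s \<in> {t0..t}. d s x \<le> 0}"
  have "continuous_on {t0..t} (\<lambda>s. d s x)"
    by (rule continuous_on_subset[OF d_cont]) (use \<open>0 \<le> t0\<close> in auto)
  then have "closed S"
    unfolding S_def by (intro continuous_on_closed_Collect_le continuous_on_const) auto
  have "t0 \<in> S" using assms(2,3) t by (auto simp: S_def)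
  have "bdd_above S" by (auto simp: S_def)
  define t1 where "t1 = Sup S"
  have "t1 \<in> S" unfolding t1_def by (rule closed_contains_Sup) (use \<open>closed S\<close> \<open>t0 \<in> S\<close> \<open>bdd_above S\<close> in auto)
  have after: "0 < d s x" if "t1 < s" "s \<le> t" for s
  proof (rule ccontr)
    assume "\<not> 0 < d s x"
    then have "s \<in> S" using that \<open>t1 \<in> S\<close> by (auto simp: S_def)
    then have "s \<le> t1" unfolding t1_def using \<open>bdd_above S\<close> by (rule cSup_upper)
    then show False using that by simp
  qed
  have t1: "t0 \<le> t1" "t1 \<le> t" "d t1 x \<le> 0" using \<open>t1 \<in> S\<close> by (auto simp: S_def)
  have "d t x - d t1 x \<le> ((lam + 1) * D) * (t - t1)"
  \<comment> \<open>The discarded time is the one at which the kink \<open>y0\<close> passes the location \<open>x\<close>.\<close>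
  proof (rule Lipschitz_increment_le[where N = "{(x - y0) / c}"])
    show "(L * c + (lam + 1))-lipschitz_on {t1..t} (\<lambda>t. d t x)"
      by (rule lipschitz_on_subset[OF d_Lip]) (use t1 \<open>0 \<le> t0\<close> in auto)
    fix s D' assume s: "s \<in> {t1<..<t} - {(x - y0) / c}"
      and D': "((\<lambda>t. d t x) has_real_derivative D') (at s)"
    define y where "y = x - c * s"
    have "y \<noteq> y0" using s c by (auto simp: y_def field_simps)
    have "0 < s" using s t1 \<open>0 \<le> t0\<close> by auto
    have "0 < d s x" using after s by auto
    then have "0 < w y" using f_bounds[of s x] \<open>0 < s\<close> by (simp add: d_def y_def)
    obtain w' where w': "(w has_real_derivative w') (at y)"
       "w' = 0 \<or> - c * w' \<le> lam * (\<integral>\<omega>. w (y - Y \<omega>) - w y \<partial>\<Omega>) + w y * (1 - w y)"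
      using w_sub[OF \<open>0 < w y\<close> \<open>y \<noteq> y0\<close>] by auto
    have "((\<lambda>t. w (x - c * t)) has_real_derivative w' * (- c)) (at s)"
      using w'(1) unfolding y_def
      by (rule DERIV_chain2[where g = "\<lambda>t. x - c * t"]) (auto intro!: derivative_eq_intros)
    then have "((\<lambda>t. d t x - w (x - c * t) + 1) has_real_derivative (D' - w' * (- c) + 0)) (at s)"
      using D' by (intro DERIV_add DERIV_diff DERIV_const)
    then have fD: "((\<lambda>t. f t x) has_real_derivative (D' + c * w')) (at s)"
      by (simp add: d_def algebra_simps)
    show "D' \<le> (lam + 1) * D"
      using w'(2)
    proof
      assume "w' = 0"
      then have "D' \<le> 0" using f_deriv_nonpos[OF \<open>0 < s\<close> fD] by simp
      also have "0 \<le> (lam + 1) * D" using lam \<open>0 \<le> D\<close> by simp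
      finally show ?thesis .
    next
      assume w_le: "- c * w' \<le> lam * (\<integral>\<omega>. w (y - Y \<omega>) - w y \<partial>\<Omega>) + w y * (1 - w y)"
      have [measurable]: "w \<in> borel_measurable borel"
        by (intro borel_measurable_continuous_onI lipschitz_on_continuous_on[OF w_Lip])
      have [measurable]: "f s \<in> borel_measurable borel"
        by (rule borel_measurable_mono) (use f_mono \<open>0 < s\<close> in auto)
      have intw: "integrable \<Omega> (\<lambda>\<omega>. w (y - Y \<omega>) - w y)"
        by (intro Bochner_Integration.integrable_diff P.integrable_const
              P.integrable_const_bound[of _ 1]) (auto simp: profile_bounds)
      have intf: "integrable \<Omega> (\<lambda>\<omega>. f s x - f s (x - Y \<omega>))"
        by (intro Bochner_Integration.integrable_diff P.integrable_const
              P.integrable_const_bound[of _ 1]) (use f_bounds \<open>0 < s\<close> in auto)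
      have "(\<integral>\<omega>. w (y - Y \<omega>) - w y \<partial>\<Omega>) - (\<integral>\<omega>. f s x - f s (x - Y \<omega>) \<partial>\<Omega>)
          = (\<integral>\<omega>. (w (y - Y \<omega>) - w y) - (f s x - f s (x - Y \<omega>)) \<partial>\<Omega>)"
        by (rule Bochner_Integration.integral_diff[symmetric, OF intw intf])
      also have "\<dots> = (\<integral>\<omega>. d s (x - Y \<omega>) - d s x \<partial>\<Omega>)"
        by (rule Bochner_Integration.integral_cong) (auto simp: d_def y_def algebra_simps)
      also have "\<dots> \<le> (\<integral>\<omega>. D - d s x \<partial>\<Omega>)"
      proof (rule integral_mono)
        show "integrable \<Omega> (\<lambda>\<omega>. d s (x - Y \<omega>) - d s x)"
          using Bochner_Integration.integrable_diff[OF intw intf]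
          by (rule Bochner_Integration.integrable_cong[THEN iffD1, rotated -1])
             (auto simp: d_def y_def algebra_simps)
        show "d s (x - Y \<omega>) - d s x \<le> D - d s x" for \<omega>
          using dD[of s "x - Y \<omega>"] s t t1 by simp
      qed simp
      also have "\<dots> = D - d s x" by (simp add: P.prob_space)
      finally have E: "(\<integral>\<omega>. w (y - Y \<omega>) - w y \<partial>\<Omega>) - (\<integral>\<omega>. f s x - f s (x - Y \<omega>) \<partial>\<Omega>) \<le> D - d s x" .
      have "D' = (D' + c * w') + - c * w'" by simp
      also have "\<dots> \<le> (- lam * (\<integral>\<omega>. f s x - f s (x - Y \<omega>) \<partial>\<Omega>) - f s x * (1 - f s x))
          + (lam * (\<integral>\<omega>. w (y - Y \<omega>) - w y \<partial>\<Omega>) + w y * (1 - w y))"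
        by (intro add_mono f_deriv[OF \<open>0 < s\<close> fD] w_le)
      also have "\<dots> = lam * ((\<integral>\<omega>. w (y - Y \<omega>) - w y \<partial>\<Omega>) - (\<integral>\<omega>. f s x - f s (x - Y \<omega>) \<partial>\<Omega>))
          + d s x * (f s x - w y)"
        by (simp add: d_def y_def algebra_simps)
      also have "\<dots> \<le> lam * (D - d s x) + d s x * 1"
        using lam \<open>0 < d s x\<close> f_bounds[of s x] profile_bounds[of y] \<open>0 < s\<close>
        by (intro add_mono mult_left_mono E) auto
      also have "\<dots> \<le> lam * D + D"
        using lam \<open>0 < d s x\<close> dD[of s x] s t t1 by (simp add: algebra_simps) (smt (verit) mult_pos_pos)
      finally show ?thesis by (simp add: algebra_simps)
    qed
  qed (use t1 in auto)
  also have "\<dots> \<le> ((lam + 1) * D) * (1 / (2 * (lam + 1)))"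
    using t t1 lam \<open>0 \<le> D\<close> by (intro mult_left_mono) auto
  also have "\<dots> = D / 2" using lam by (simp add: field_simps)
  finally show ?thesis using t1 by simp
qed

text \<open>
  On one time strip the excess is at most one, hence by repeated halving at most zero; then the
  argument restarts at the end of the strip.
\<close>

lemma travelling_subsolution_stays_below:
  assumes init: "\<And>x. w x \<le> 1 - f 0 x" and "0 \<le> t"
  shows "w (x - c * t) \<le> 1 - f t x"
proof -
  define T where "T = 1 / (2 * (lam + 1))"
  have "T > 0" using lam by (simp add: T_def)
  have step: "w (x - c * t) + f t x - 1 \<le> 0"
    if "0 \<le> t0" "\<And>x. w (x - c * t0) + f t0 x - 1 \<le> 0" "t0 \<le> t" "t \<le> t0 + T" for t0 t x
  proof -
    have pow: "w (x - c * t) + f t x - 1 \<le> (1/2) ^ n" if "t0 \<le> t" "t \<le> t0 + T" for n t x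
      using that
    proof (induction n arbitrary: t x)
      case 0
      then show ?case using f_bounds[of t x] profile_bounds[of "x - c * t"] \<open>0 \<le> t0\<close> by simp
    next
      case (Suc n)
      have "w (x - c * t) + f t x - 1 \<le> (1/2) ^ n / 2"
        by (rule excess_halves[OF \<open>0 \<le> t0\<close> \<open>\<And>x. w (x - c * t0) + f t0 x - 1 \<le> 0\<close>])
           (use Suc in \<open>auto simp: T_def\<close>)
      then show ?case by simp
    qed
    have "(\<lambda>n. (1/2::real) ^ n) \<longlonglongrightarrow> 0" by (rule LIMSEQ_realpow_zero) auto
    then show ?thesis
      by (rule tendsto_lowerbound) (use pow that in auto)
  qed
  have "\<forall>x t. real n * T \<le> t \<and> t \<le> real n * T + T \<longrightarrow> w (x - c * t) + f t x - 1 \<le> 0" for n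
  proof (induction n)
    case 0
    have "w (x - c * t) + f t x - 1 \<le> 0" if "0 \<le> t" "t \<le> T" for x t
    proof (rule step[of 0])
      show "w (x - c * 0) + f 0 x - 1 \<le> 0" for x using init[of x] by simp
    qed (use that in auto)
    then show ?case by simp
  next
    case (Suc n)
    show ?case
    proof (intro allI impI)
      fix x t assume t: "real (Suc n) * T \<le> t \<and> t \<le> real (Suc n) * T + T"
      show "w (x - c * t) + f t x - 1 \<le> 0"
      proof (rule step[of "real (Suc n) * T"])
        show "w (x - c * (real (Suc n) * T)) + f (real (Suc n) * T) x - 1 \<le> 0" for x
          using Suc[THEN spec, of x, THEN spec, of "real (Suc n) * T"] \<open>T > 0\<close>
          by (simp add: distrib_right)
      qed (use t \<open>T > 0\<close> in auto)
    qed
  qed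
  moreover have "real (nat \<lfloor>t / T\<rfloor>) * T \<le> t \<and> t \<le> real (nat \<lfloor>t / T\<rfloor>) * T + T"
  proof -
    have "0 \<le> t / T" using \<open>0 \<le> t\<close> \<open>T > 0\<close> by simp
    then have "real (nat \<lfloor>t / T\<rfloor>) = of_int \<lfloor>t / T\<rfloor>" by simp
    then have "real (nat \<lfloor>t / T\<rfloor>) \<le> t / T" "t / T \<le> real (nat \<lfloor>t / T\<rfloor>) + 1" by linarith+
    then show ?thesis using \<open>T > 0\<close> by (simp add: field_simps)
  qed
  ultimately have "w (x - c * t) + f t x - 1 \<le> 0" by blast
  then show ?thesis by simp
qed

end

section \<open>Construction of a travelling subsolution\<close>

lemma one_minus_half_square_le_cos: "1 - x\<^sup>2 / 2 \<le> cos (x::real)"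
proof -
  have "(sin (x/2))\<^sup>2 \<le> (x/2)\<^sup>2"
    using abs_sin_x_le_abs_x[of "x/2"] by (rule abs_le_square_iff[THEN iffD1])
  then show ?thesis using cos_double_sin[of "x/2"] by (simp add: power_divide)
qed

lemma mult_cos_le_sin:
  assumes "0 \<le> x" "x \<le> pi" shows "x * cos x \<le> sin (x::real)"
proof -
  have "sin 0 - 0 * cos 0 \<le> sin x - x * cos x"
  proof (rule DERIV_nonneg_imp_nondecreasing[OF assms(1)])
    fix u :: real assume u: "0 \<le> u" "u \<le> x"
    have "((\<lambda>u. sin u - u * cos u) has_real_derivative u * sin u) (at u)"
      by (auto intro!: derivative_eq_intros simp: algebra_simps)
    moreover have "0 \<le> u * sin u"
      using u assms by (intro mult_nonneg_nonneg sin_ge_zero) auto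
    ultimately show "\<exists>y. ((\<lambda>u. sin u - u * cos u) has_real_derivative y) (at u) \<and> 0 \<le> y"
      by blast
  qed
  then show ?thesis by simp
qed

context
  fixes \<Omega> :: "'w measure" and Y :: "'w \<Rightarrow> real" and C :: real
  assumes "prob_space \<Omega>" and Y[measurable]: "Y \<in> borel_measurable \<Omega>"
    and Y_bounds: "\<And>\<omega>. 0 \<le> Y \<omega> \<and> Y \<omega> \<le> C"
begin

interpretation P: prob_space \<Omega> by fact

lemma integrable_continuous_of_bounded:
  assumes "continuous_on UNIV h"
  shows "integrable \<Omega> (\<lambda>\<omega>. h (Y \<omega>) :: real)"
proof -
  have "bounded (h ` {0..C})"
    by (intro compact_imp_bounded compact_continuous_image continuous_on_subset[OF assms]) auto
  then obtain B where "\<forall>z\<in>h ` {0..C}. norm z \<le> B"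
    unfolding bounded_iff by blast
  moreover have [measurable]: "h \<in> borel_measurable borel"
    using assms by (rule borel_measurable_continuous_onI)
  ultimately show ?thesis
    by (intro P.integrable_const_bound[of _ B]) (use Y_bounds in auto)
qed

lemma expectation_mono_of_bounded:
  assumes "continuous_on UNIV h" "continuous_on UNIV k"
    and "\<And>z. 0 \<le> z \<Longrightarrow> z \<le> C \<Longrightarrow> h z \<le> (k z :: real)"
  shows "(\<integral>\<omega>. h (Y \<omega>) \<partial>\<Omega>) \<le> (\<integral>\<omega>. k (Y \<omega>) \<partial>\<Omega>)"
  by (rule integral_mono) (use assms Y_bounds in \<open>auto intro: integrable_continuous_of_bounded\<close>)

lemma continuous_expectation_exp:
  assumes h: "continuous_on UNIV h"
  shows "continuous_on UNIV (\<lambda>\<zeta>. \<integral>\<omega>. h (Y \<omega>) * exp (\<zeta> * Y \<omega>) \<partial>\<Omega>)"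
proof (rule continuous_on_sequentiallyI)
  fix u :: "nat \<Rightarrow> real" and \<zeta> assume u: "u \<longlonglongrightarrow> \<zeta>"
  have [measurable]: "h \<in> borel_measurable borel"
    using assms by (rule borel_measurable_continuous_onI)
  obtain R where R: "\<And>n. \<bar>u n\<bar> \<le> R"
    using convergent_imp_Bseq[OF convergentI[OF u]] by (auto simp: Bseq_def)
  show "(\<lambda>n. \<integral>\<omega>. h (Y \<omega>) * exp (u n * Y \<omega>) \<partial>\<Omega>) \<longlonglongrightarrow> (\<integral>\<omega>. h (Y \<omega>) * exp (\<zeta> * Y \<omega>) \<partial>\<Omega>)"
  proof (rule integral_dominated_convergence[where w = "\<lambda>\<omega>. \<bar>h (Y \<omega>)\<bar> * exp (R * Y \<omega>)"])
    show "integrable \<Omega> (\<lambda>\<omega>. \<bar>h (Y \<omega>)\<bar> * exp (R * Y \<omega>))"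
      by (rule integrable_continuous_of_bounded) (intro continuous_intros h)
    show "AE \<omega> in \<Omega>. norm (h (Y \<omega>) * exp (u n * Y \<omega>)) \<le> \<bar>h (Y \<omega>)\<bar> * exp (R * Y \<omega>)" for n
    proof (rule AE_I2)
      fix \<omega>
      have "u n * Y \<omega> \<le> R * Y \<omega>"
        using R[of n] Y_bounds[of \<omega>] by (intro mult_right_mono) auto
      then show "norm (h (Y \<omega>) * exp (u n * Y \<omega>)) \<le> \<bar>h (Y \<omega>)\<bar> * exp (R * Y \<omega>)"
        by (simp add: abs_mult mult_left_mono)
    qed
    show "AE \<omega> in \<Omega>. (\<lambda>n. h (Y \<omega>) * exp (u n * Y \<omega>)) \<longlonglongrightarrow> h (Y \<omega>) * exp (\<zeta> * Y \<omega>)"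
      by (intro AE_I2 tendsto_intros u)
  qed measurable
qed

text \<open>
  With \<open>\<phi> y = exp(-s y) cos(\<gamma> y)\<close> one finds
  \<open>E \<phi>(y - Y) = exp(-s y) (a cos(\<gamma> y) + b sin(\<gamma> y))\<close>, where \<open>a = E exp(sY) cos(\<gamma> Y)\<close> and
  \<open>b = E exp(sY) sin(\<gamma> Y)\<close>. In the subsolution inequality for \<open>\<phi>\<close> at speed \<open>c\<close> the sine terms cancel for the
  choice \<open>c = lam b / \<gamma>\<close>, and the cosine terms leave the factor \<open>lam (a - 1) + 1 - \<epsilon> - c s\<close>. As
  \<open>\<gamma>\<close> tends to zero, \<open>a\<close> and \<open>c\<close> tend to \<open>M\<close> and \<open>g\<close>, so the growth assumption makes this factor
  nonnegative for small \<open>\<gamma>\<close> and \<open>\<epsilon>\<close>.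

  Left of its maximum \<open>\<phi>\<close> is replaced by a plateau, right of its zero \<open>B\<close> by zero. The replacement can
  only increase the expectation, provided that jumps from the arch do not reach beyond the negative
  half wave of \<open>\<phi>\<close> on the left; this is ensured by \<open>\<gamma> C < \<pi>\<close>. The plateau gives the profile its use: it
  bounds solutions from below on a whole half line.
\<close>

lemma travelling_subsolution_exists:
  fixes lam s v :: real
  defines "M \<equiv> \<integral>\<omega>. exp (s * Y \<omega>) \<partial>\<Omega>" and "g \<equiv> lam * (\<integral>\<omega>. Y \<omega> * exp (s * Y \<omega>) \<partial>\<Omega>)"
  assumes "lam > 0" "s \<ge> 0" "g > 0" "v < g" and growth: "lam * (M - 1) + 1 - s * g > 0"
  obtains \<epsilon> c w B y0 where
    "0 < \<epsilon>" "\<epsilon> < 1" "0 < c" "v < c" "travelling_subsolution lam \<Omega> Y c w"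
    "\<forall>y. w y \<le> \<epsilon>" "\<forall>y\<ge>B. w y = 0" "\<forall>y\<le>y0. w y = \<epsilon>"
proof -
  \<comment> \<open>The factor \<open>\<kappa> \<gamma>\<close> is a lower bound for both \<open>cos (\<gamma> Y)\<close> and \<open>sin (\<gamma> Y) / (\<gamma> Y)\<close>.\<close>
  define \<kappa> where "\<kappa> = (\<lambda>\<gamma>::real. 1 - (\<gamma> * C)\<^sup>2 / 2)"
  define h where "h = (\<lambda>\<gamma>. lam * (\<kappa> \<gamma> * M - 1) + 1 - s * g)"
  obtain \<gamma> where \<gamma>: "0 < \<gamma>" "\<gamma> * C < pi" "0 < \<kappa> \<gamma> * g" "v < \<kappa> \<gamma> * g" "0 < h \<gamma>"
  proof -
    have \<kappa>_lim: "(\<kappa> \<longlongrightarrow> 1) (at_right 0)"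
      unfolding \<kappa>_def by (auto intro!: tendsto_eq_intros)
    have "((\<lambda>\<gamma>. \<gamma> * C) \<longlongrightarrow> 0) (at_right 0)" by (auto intro!: tendsto_eq_intros)
    moreover have "((\<lambda>\<gamma>. \<kappa> \<gamma> * g) \<longlongrightarrow> g) (at_right 0)" using \<kappa>_lim by (auto intro!: tendsto_eq_intros)
    moreover have "(h \<longlongrightarrow> lam * (M - 1) + 1 - s * g) (at_right 0)"
      unfolding h_def using \<kappa>_lim by (auto intro!: tendsto_eq_intros)
    ultimately have "\<forall>\<^sub>F \<gamma> in at_right 0. 0 < \<gamma> \<and> \<gamma> * C < pi \<and> 0 < \<kappa> \<gamma> * g \<and> v < \<kappa> \<gamma> * g \<and> 0 < h \<gamma>"
      using \<open>g > 0\<close> \<open>v < g\<close> growth \<kappa>_lim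
      by (intro eventually_conj) (auto intro: order_tendstoD eventually_at_right_less)
    from eventually_happens'[OF _ this] show thesis using that by auto
  qed
  define a where "a = (\<integral>\<omega>. exp (s * Y \<omega>) * cos (\<gamma> * Y \<omega>) \<partial>\<Omega>)"
  define b where "b = (\<integral>\<omega>. exp (s * Y \<omega>) * sin (\<gamma> * Y \<omega>) \<partial>\<Omega>)"
  define c where "c = lam * b / \<gamma>"
  define \<epsilon> where "\<epsilon> = min (1/2) (h \<gamma>)"
  have \<epsilon>: "0 < \<epsilon>" "\<epsilon> < 1" "\<epsilon> \<le> h \<gamma>" using \<gamma> by (auto simp: \<epsilon>_def)
  have cos_ge: "\<kappa> \<gamma> \<le> cos (\<gamma> * z)" if "0 \<le> z" "z \<le> C" for z
  proof -
    have "(\<gamma> * z)\<^sup>2 \<le> (\<gamma> * C)\<^sup>2" using that \<gamma>(1) by (intro power_mono mult_left_mono) auto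
    then show ?thesis using one_minus_half_square_le_cos[of "\<gamma> * z"] by (simp add: \<kappa>_def)
  qed
  have "\<kappa> \<gamma> * M \<le> a"
  proof -
    have "(\<integral>\<omega>. \<kappa> \<gamma> * exp (s * Y \<omega>) \<partial>\<Omega>) \<le> a"
      unfolding a_def
    proof (rule expectation_mono_of_bounded[where h = "\<lambda>z. \<kappa> \<gamma> * exp (s * z)"])
      show "\<kappa> \<gamma> * exp (s * z) \<le> exp (s * z) * cos (\<gamma> * z)" if "0 \<le> z" "z \<le> C" for z
        using cos_ge[OF that] by simp
    qed (auto intro!: continuous_intros)
    then show ?thesis by (simp add: M_def)
  qed
  have "lam * b \<le> \<gamma> * g"
  proof -
    have "b \<le> (\<integral>\<omega>. \<gamma> * (Y \<omega> * exp (s * Y \<omega>)) \<partial>\<Omega>)"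
      unfolding b_def
    proof (rule expectation_mono_of_bounded[where k = "\<lambda>z. \<gamma> * (z * exp (s * z))"])
      fix z assume "0 \<le> z" "z \<le> C"
      then have "exp (s * z) * sin (\<gamma> * z) \<le> exp (s * z) * (\<gamma> * z)"
        using \<gamma>(1) by (intro mult_left_mono sin_x_le_x) auto
      then show "exp (s * z) * sin (\<gamma> * z) \<le> \<gamma> * (z * exp (s * z))" by (simp add: mult_ac)
    qed (auto intro!: continuous_intros)
    then have "lam * b \<le> lam * (\<gamma> * (\<integral>\<omega>. Y \<omega> * exp (s * Y \<omega>) \<partial>\<Omega>))"
      using \<open>lam > 0\<close> by simp
    then show ?thesis by (simp add: g_def mult_ac)
  qed
  then have "c \<le> g" using \<gamma>(1) by (simp add: c_def pos_divide_le_eq mult.commute)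
  have "\<gamma> * (\<kappa> \<gamma> * g) \<le> lam * b"
  proof -
    have "(\<integral>\<omega>. \<kappa> \<gamma> * \<gamma> * (Y \<omega> * exp (s * Y \<omega>)) \<partial>\<Omega>) \<le> b"
      unfolding b_def
    proof (rule expectation_mono_of_bounded[where h = "\<lambda>z. \<kappa> \<gamma> * \<gamma> * (z * exp (s * z))"])
      fix z assume z: "0 \<le> z" "z \<le> C"
      have "\<gamma> * z \<le> pi" using mult_left_mono[of z C \<gamma>] z \<gamma>(1,2) by linarith
      have "\<gamma> * z * \<kappa> \<gamma> \<le> \<gamma> * z * cos (\<gamma> * z)"
        using z \<gamma>(1) cos_ge by (intro mult_left_mono) auto
      also have "\<dots> \<le> sin (\<gamma> * z)"
        using z \<gamma>(1) \<open>\<gamma> * z \<le> pi\<close> by (intro mult_cos_le_sin) auto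
      finally have "exp (s * z) * (\<gamma> * z * \<kappa> \<gamma>) \<le> exp (s * z) * sin (\<gamma> * z)"
        by (rule mult_left_mono) simp
      then show "\<kappa> \<gamma> * \<gamma> * (z * exp (s * z)) \<le> exp (s * z) * sin (\<gamma> * z)"
        by (simp add: mult_ac)
    qed (auto intro!: continuous_intros)
    then have "lam * (\<kappa> \<gamma> * \<gamma> * (\<integral>\<omega>. Y \<omega> * exp (s * Y \<omega>) \<partial>\<Omega>)) \<le> lam * b"
      using \<open>lam > 0\<close> by simp
    then show ?thesis by (simp add: g_def mult_ac)
  qed
  then have "\<kappa> \<gamma> * g \<le> c" using \<gamma>(1) by (simp add: c_def pos_le_divide_eq mult.commute)
  then have c: "0 < c" "v < c" using \<gamma>(3,4) by auto
  have growth': "0 \<le> lam * (a - 1) + 1 - \<epsilon> - c * s"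
  proof -
    have "lam * (\<kappa> \<gamma> * M) \<le> lam * a" using \<open>\<kappa> \<gamma> * M \<le> a\<close> \<open>lam > 0\<close> by simp
    moreover have "c * s \<le> s * g" using mult_left_mono[OF \<open>c \<le> g\<close> \<open>s \<ge> 0\<close>] by (simp add: mult.commute)
    ultimately show ?thesis using \<epsilon>(3) by (simp add: h_def algebra_simps)
  qed

  define B where "B = pi / (2 * \<gamma>)"
  have B: "0 < B" "\<gamma> * B = pi / 2" "C < 2 * B"
    using \<gamma>(1,2) by (auto simp: B_def field_simps)
  define \<phi> where "\<phi> = (\<lambda>y. exp (- s * y) * cos (\<gamma> * y))"
  define \<phi>' where "\<phi>' = (\<lambda>y. exp (- s * y) * (- s * cos (\<gamma> * y) - \<gamma> * sin (\<gamma> * y)))"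
  have \<phi>_deriv: "(\<phi> has_real_derivative \<phi>' y) (at y)" for y
    unfolding \<phi>_def \<phi>'_def by (auto intro!: derivative_eq_intros simp: algebra_simps)
  have \<phi>_cont: "continuous_on S \<phi>" for S
    unfolding \<phi>_def by (intro continuous_intros)
  have \<gamma>y: "- (pi/2) \<le> \<gamma> * y \<and> \<gamma> * y \<le> pi/2" if "- B \<le> y" "y \<le> B" for y
  proof -
    have "\<gamma> * - B \<le> \<gamma> * y" "\<gamma> * y \<le> \<gamma> * B" using that \<gamma>(1) by (intro mult_left_mono; simp)+
    then show ?thesis using B(2) by simp
  qed
  have \<phi>_nonneg: "0 \<le> \<phi> y" if "- B \<le> y" "y \<le> B" for y
    unfolding \<phi>_def using \<gamma>y[OF that] by (intro mult_nonneg_nonneg cos_ge_zero) auto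
  have \<phi>_nonpos: "\<phi> y \<le> 0" if "- (3 * B) \<le> y" "y \<le> - B" for y
  proof -
    have "\<gamma> * - (3 * B) \<le> \<gamma> * y" "\<gamma> * y \<le> \<gamma> * - B"
      using that \<gamma>(1) by (intro mult_left_mono; simp)+
    then have "\<gamma> * y + pi \<le> pi / 2" "- (pi / 2) \<le> \<gamma> * y + pi"
      using B(2) by (auto simp: mult.left_commute[of _ 3])
    then have "0 \<le> cos (\<gamma> * y + pi)" by (intro cos_ge_zero) auto
    then show ?thesis unfolding \<phi>_def by (intro mult_nonneg_nonpos) auto
  qed
  have \<phi>_ends: "\<phi> B = 0" "\<phi> (- B) = 0" by (simp_all add: \<phi>_def B(2))
  obtain y0 where y0: "- B \<le> y0" "y0 \<le> B" and y0_max: "\<And>y. - B \<le> y \<Longrightarrow> y \<le> B \<Longrightarrow> \<phi> y \<le> \<phi> y0"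
    using continuous_attains_sup[of "{- B..B}" \<phi>] \<phi>_cont B(1) by auto
  have "\<phi> 0 \<le> \<phi> y0" using B(1) by (intro y0_max) auto
  then have top: "1 \<le> \<phi> y0" by (simp add: \<phi>_def)
  then have y0': "- B < y0" "y0 < B" using y0 \<phi>_ends by (auto simp: less_le)
  \<comment> \<open>Height \<open>\<epsilon>\<close> for the plateau makes \<open>w (1 - w) \<ge> (1 - \<epsilon>) w\<close>, which linearizes the reaction term.\<close>
  define m where "m = \<epsilon> / \<phi> y0"
  have m: "0 < m" "m * \<phi> y0 = \<epsilon>" using \<epsilon>(1) top by (auto simp: m_def)
  \<comment> \<open>Clamping the argument to the interval from \<open>y0\<close> to \<open>B\<close> produces the plateau and the zero part at once.\<close>
  define w where "w = (\<lambda>y. m * \<phi> (max y0 (min B y)))"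
  have w_le: "w y = \<epsilon>" if "y \<le> y0" for y
  proof -
    have "max y0 (min B y) = y0" using that by auto
    then show ?thesis using m by (simp add: w_def)
  qed
  have w_mid: "w y = m * \<phi> y" if "y0 \<le> y" "y \<le> B" for y
  proof -
    have "max y0 (min B y) = y" using that by auto
    then show ?thesis by (simp add: w_def)
  qed
  have w_ge: "w y = 0" if "B \<le> y" for y
  proof -
    have "max y0 (min B y) = B" using that y0 by auto
    then show ?thesis using \<phi>_ends by (simp add: w_def)
  qed
  have w_bounds: "0 \<le> w y \<and> w y \<le> \<epsilon>" for y
  proof -
    have "- B \<le> max y0 (min B y)" "max y0 (min B y) \<le> B" using y0 by auto
    note * = \<phi>_nonneg[OF this] y0_max[OF this]
    have "m * \<phi> (max y0 (min B y)) \<le> m * \<phi> y0" using * m(1) by simp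
    then show ?thesis using * m by (simp add: w_def)
  qed
  have w_above: "m * \<phi> y \<le> w y" if "- (3 * B) \<le> y" "y \<le> B" for y
  proof -
    consider "y \<le> - B" | "- B \<le> y" "y \<le> y0" | "y0 \<le> y" by linarith
    then show ?thesis
    proof cases
      case 1
      then show ?thesis
        using mult_nonneg_nonpos[of m "\<phi> y"] \<phi>_nonpos[of y] that m(1) w_bounds[of y] by linarith
    next
      case 2
      then show ?thesis using mult_left_mono[of "\<phi> y" "\<phi> y0" m] y0_max[of y] w_le[of y] m y0 by linarith
    next
      case 3
      then show ?thesis using w_mid[of y] that by simp
    qed
  qed
  define L where "L = m * (exp (s * B) * (s + \<gamma>))"
  have "L-lipschitz_on UNIV w"
  proof (rule lipschitz_onI)
    show "0 \<le> L" unfolding L_def using m \<open>s \<ge> 0\<close> \<gamma>(1) by simp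
    fix x y :: real
    define cx where "cx = max y0 (min B x)"
    define cy where "cy = max y0 (min B y)"
    have cxy: "cx \<in> {- B..B}" "cy \<in> {- B..B}" using y0 by (auto simp: cx_def cy_def)
    have "norm (\<phi> cx - \<phi> cy) \<le> (exp (s * B) * (s + \<gamma>)) * norm (cx - cy)"
    proof (rule field_differentiable_bound[of "{- B..B}" \<phi> \<phi>'])
      fix z assume z: "z \<in> {- B..B}"
      show "(\<phi> has_real_derivative \<phi>' z) (at z within {- B..B})"
        using \<phi>_deriv has_field_derivative_at_within by blast
      have "\<bar>- s * cos (\<gamma> * z) - \<gamma> * sin (\<gamma> * z)\<bar> \<le> \<bar>s * cos (\<gamma> * z)\<bar> + \<bar>\<gamma> * sin (\<gamma> * z)\<bar>"
        by linarith
      also have "\<dots> \<le> s * 1 + \<gamma> * 1"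
        unfolding abs_mult using \<open>s \<ge> 0\<close> \<gamma>(1) by (intro add_mono mult_mono) auto
      finally have "\<bar>- s * cos (\<gamma> * z) - \<gamma> * sin (\<gamma> * z)\<bar> \<le> s + \<gamma>" by simp
      moreover have "exp (- s * z) \<le> exp (s * B)"
        using z \<open>s \<ge> 0\<close> mult_left_mono[of "- z" B s] by simp
      ultimately show "norm (\<phi>' z) \<le> exp (s * B) * (s + \<gamma>)"
        unfolding \<phi>'_def real_norm_def abs_mult using \<open>s \<ge> 0\<close> \<gamma>(1) by (intro mult_mono) auto
    qed (use cxy in auto)
    then have \<phi>_diff: "\<bar>\<phi> cx - \<phi> cy\<bar> \<le> exp (s * B) * (s + \<gamma>) * \<bar>cx - cy\<bar>" by simp
    have "w x - w y = m * (\<phi> cx - \<phi> cy)"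
      by (simp add: w_def cx_def cy_def right_diff_distrib)
    then have "\<bar>w x - w y\<bar> = m * \<bar>\<phi> cx - \<phi> cy\<bar>" using m(1) by (simp add: abs_mult)
    also have "\<dots> \<le> m * (exp (s * B) * (s + \<gamma>) * \<bar>cx - cy\<bar>)"
      using m(1) by (intro mult_left_mono \<phi>_diff) simp
    also have "\<dots> = L * \<bar>cx - cy\<bar>" by (simp add: L_def)
    also have "\<dots> \<le> L * \<bar>x - y\<bar>"
    proof (rule mult_left_mono[OF _ \<open>0 \<le> L\<close>])
      show "\<bar>cx - cy\<bar> \<le> \<bar>x - y\<bar>" by (auto simp: cx_def cy_def max_def min_def)
    qed
    finally show "dist (w x) (w y) \<le> L * dist x y" by (simp add: dist_real_def)
  qed
  moreover have "\<exists>w'. (w has_real_derivative w') (at y) \<and>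
        (w' = 0 \<or> - c * w' \<le> lam * (\<integral>\<omega>. w (y - Y \<omega>) - w y \<partial>\<Omega>) + w y * (1 - w y))"
    if "w y > 0" "y \<noteq> y0" for y
  proof (cases "y < y0")
    case True
    have "(w has_real_derivative 0) (at y)"
      by (rule has_field_derivative_transform_within_open[of "\<lambda>_. \<epsilon>" _ _ "{..<y0}"])
         (use True w_le in auto)
    then show ?thesis by blast
  next
    case False
    then have y: "y0 < y" "y < B" using that w_ge[of y] by force+
    have w': "(w has_real_derivative m * \<phi>' y) (at y)"
      by (rule has_field_derivative_transform_within_open[of "\<lambda>y. m * \<phi> y" _ _ "{y0<..<B}"])
         (use y w_mid in \<open>auto intro: DERIV_cmult \<phi>_deriv\<close>)
    have w_cont: "continuous_on UNIV w"
      unfolding w_def by (intro continuous_intros continuous_on_compose2[OF \<phi>_cont[of UNIV]]) auto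
    have shift: "\<phi> (y - z) = exp (- s * y) * (cos (\<gamma> * y) * (exp (s * z) * cos (\<gamma> * z))
          + sin (\<gamma> * y) * (exp (s * z) * sin (\<gamma> * z)))" for z
    proof -
      have "exp (- s * (y - z)) = exp (- s * y) * exp (s * z)"
        by (simp add: algebra_simps flip: exp_add)
      moreover have "cos (\<gamma> * (y - z)) = cos (\<gamma> * y) * cos (\<gamma> * z) + sin (\<gamma> * y) * sin (\<gamma> * z)"
        by (simp add: right_diff_distrib cos_diff)
      ultimately show ?thesis unfolding \<phi>_def by (simp add: distrib_left mult_ac)
    qed
    have "(\<integral>\<omega>. m * \<phi> (y - Y \<omega>) - m * \<phi> y \<partial>\<Omega>)
        = m * (exp (- s * y) * (cos (\<gamma> * y) * a + sin (\<gamma> * y) * b)) - m * \<phi> y"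
    proof -
      have i: "integrable \<Omega> (\<lambda>\<omega>. exp (s * Y \<omega>) * cos (\<gamma> * Y \<omega>))"
        "integrable \<Omega> (\<lambda>\<omega>. exp (s * Y \<omega>) * sin (\<gamma> * Y \<omega>))"
        by (rule integrable_continuous_of_bounded, intro continuous_intros)+
      show ?thesis unfolding shift a_def b_def using i by (simp add: P.prob_space)
    qed
    moreover have "(\<integral>\<omega>. m * \<phi> (y - Y \<omega>) - m * \<phi> y \<partial>\<Omega>) \<le> (\<integral>\<omega>. w (y - Y \<omega>) - w y \<partial>\<Omega>)"
    proof (rule expectation_mono_of_bounded[where h = "\<lambda>z. m * \<phi> (y - z) - m * \<phi> y"
          and k = "\<lambda>z. w (y - z) - w y"])
      show "m * \<phi> (y - z) - m * \<phi> y \<le> w (y - z) - w y" if "0 \<le> z" "z \<le> C" for z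
        using w_above[of "y - z"] w_mid[of y] that y y0' B by simp
    qed (intro continuous_intros continuous_on_compose2[OF \<phi>_cont[of UNIV]]
          continuous_on_compose2[OF w_cont]; simp)+
    ultimately have E: "m * (exp (- s * y) * (cos (\<gamma> * y) * a + sin (\<gamma> * y) * b)) - m * \<phi> y
        \<le> (\<integral>\<omega>. w (y - Y \<omega>) - w y \<partial>\<Omega>)" by simp
    have wy: "w y = m * \<phi> y" using w_mid y by simp
    have "0 \<le> m * (\<phi> y * (lam * (a - 1) + 1 - \<epsilon> - c * s))"
      using m(1) \<phi>_nonneg[of y] y y0' growth' by (intro mult_nonneg_nonneg) auto
    also have "\<dots> = c * (m * \<phi>' y)
        + lam * (m * (exp (- s * y) * (cos (\<gamma> * y) * a + sin (\<gamma> * y) * b)) - m * \<phi> y)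
        + (m * \<phi> y) * (1 - \<epsilon>)
        + m * exp (- s * y) * sin (\<gamma> * y) * (c * \<gamma> - lam * b)"
      by (simp add: \<phi>_def \<phi>'_def algebra_simps)
    also have "c * \<gamma> - lam * b = 0" using \<gamma>(1) by (simp add: c_def)
    also have "c * (m * \<phi>' y)
        + lam * (m * (exp (- s * y) * (cos (\<gamma> * y) * a + sin (\<gamma> * y) * b)) - m * \<phi> y)
        + (m * \<phi> y) * (1 - \<epsilon>) + m * exp (- s * y) * sin (\<gamma> * y) * 0
        \<le> c * (m * \<phi>' y) + lam * (\<integral>\<omega>. w (y - Y \<omega>) - w y \<partial>\<Omega>) + w y * (1 - w y) + 0"
    proof -
      have "(m * \<phi> y) * (1 - \<epsilon>) \<le> w y * (1 - w y)"
        unfolding wy[symmetric] using w_bounds[of y] by (intro mult_left_mono) auto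
      then show ?thesis using mult_left_mono[OF E less_imp_le[OF \<open>lam > 0\<close>]] by linarith
    qed
    finally have "- c * (m * \<phi>' y) \<le> lam * (\<integral>\<omega>. w (y - Y \<omega>) - w y \<partial>\<Omega>) + w y * (1 - w y)"
      by simp
    then show ?thesis using w' by blast
  qed
  ultimately have "travelling_subsolution lam \<Omega> Y c w"
    unfolding travelling_subsolution_def
    using w_bounds \<epsilon>(2) by (meson order_trans less_imp_le)
  then show thesis
    using that[of \<epsilon> c w B y0] \<epsilon> c w_bounds w_ge w_le by blast
qed

end

section \<open>The critical speed and bounded jumps\<close>

lemma (in prob_space) expectation_pos:
  assumes "integrable M X" "AE \<omega> in M. (0::real) < X \<omega>"
  shows "0 < expectation X"
proof -
  have nn: "AE \<omega> in M. 0 \<le> X \<omega>" using assms(2) by eventually_elim simp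
  have "expectation X \<noteq> 0"
  proof
    assume "expectation X = 0"
    then have "AE \<omega> in M. X \<omega> = 0"
      using integral_nonneg_eq_0_iff_AE[OF assms(1) nn] by simp
    with assms(2) have "AE \<omega> in M. False" by eventually_elim simp
    then show False by simp
  qed
  moreover have "0 \<le> expectation X" using nn by (rule integral_nonneg_AE)
  ultimately show ?thesis by simp
qed

text \<open>
  Write \<open>g s\<close> for \<open>lam\<close> times the derivative of the moment generating function \<open>M\<close>. The function
  \<open>g\<close> is continuous and unbounded. If \<open>g 0 < v\<close>, it takes the value \<open>v\<close> at some \<open>s > 0\<close>, and the
  assumed inequality at \<open>\<zeta> = s\<close> is the claim. Otherwise \<open>s = 0\<close> works because \<open>M 0 = 1\<close>.
\<close>

lemma exists_decay_rate_of_speed: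
  fixes \<Omega> :: "'w measure" and Y :: "'w \<Rightarrow> real" and lam v :: real
  defines "M \<equiv> \<lambda>s. \<integral>\<omega>. exp (s * Y \<omega>) \<partial>\<Omega>"
    and "g \<equiv> \<lambda>s. lam * (\<integral>\<omega>. Y \<omega> * exp (s * Y \<omega>) \<partial>\<Omega>)"
  assumes "lam > 0" "prob_space \<Omega>" and Y[measurable]: "Y \<in> borel_measurable \<Omega>"
    and Y_bounds: "\<And>\<omega>. 0 \<le> Y \<omega> \<and> Y \<omega> \<le> C" and Y_pos: "AE \<omega> in \<Omega>. 0 < Y \<omega>"
    and sub: "\<And>\<zeta>. 0 < \<zeta> \<Longrightarrow> v * \<zeta> < lam * (M \<zeta> - 1) + 1"
  obtains s where "0 \<le> s" "0 < g s" "v \<le> g s" "0 < lam * (M s - 1) + 1 - s * g s"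
proof -
  interpret P: prob_space \<Omega> by fact
  note int = integrable_continuous_of_bounded[OF \<open>prob_space \<Omega>\<close> Y Y_bounds]
  note mono = expectation_mono_of_bounded[OF \<open>prob_space \<Omega>\<close> Y Y_bounds]
  have pos: "0 < g s" for s
    unfolding g_def
  proof (rule mult_pos_pos[OF \<open>lam > 0\<close>], rule P.expectation_pos)
    show "integrable \<Omega> (\<lambda>\<omega>. Y \<omega> * exp (s * Y \<omega>))"
      by (rule int) (intro continuous_intros)
    show "AE \<omega> in \<Omega>. 0 < Y \<omega> * exp (s * Y \<omega>)"
      using Y_pos by eventually_elim simp
  qed
  show thesis
  proof (cases "v \<le> g 0")
    case True
    show thesis
      by (rule that[of 0]) (use True pos in \<open>auto simp: M_def P.prob_space\<close>)
  next
    case False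
    define q where "q = (\<integral>\<omega>. Y \<omega> * Y \<omega> \<partial>\<Omega>)"
    have "0 < q"
      unfolding q_def
    proof (rule P.expectation_pos)
      show "integrable \<Omega> (\<lambda>\<omega>. Y \<omega> * Y \<omega>)" by (rule int) (intro continuous_intros)
      show "AE \<omega> in \<Omega>. 0 < Y \<omega> * Y \<omega>" using Y_pos by eventually_elim simp
    qed
    \<comment> \<open>From \<open>exp x \<ge> x\<close> follows \<open>g S \<ge> lam S q\<close>, so this \<open>S\<close> makes \<open>g S\<close> reach \<open>v\<close>.\<close>
    define S where "S = \<bar>v\<bar> / (lam * q)"
    have "0 \<le> S" using \<open>0 < q\<close> \<open>lam > 0\<close> by (simp add: S_def)
    have "(\<integral>\<omega>. S * (Y \<omega> * Y \<omega>) \<partial>\<Omega>) \<le> (\<integral>\<omega>. Y \<omega> * exp (S * Y \<omega>) \<partial>\<Omega>)"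
    proof (rule mono[where h = "\<lambda>z. S * (z * z)" and k = "\<lambda>z. z * exp (S * z)"])
      fix z :: real assume z: "0 \<le> z" "z \<le> C"
      have "S * z \<le> exp (S * z)" using exp_ge_add_one_self[of "S * z"] by linarith
      then have "z * (S * z) \<le> z * exp (S * z)" using z(1) by (rule mult_left_mono)
      then show "S * (z * z) \<le> z * exp (S * z)" by (simp add: mult_ac)
    qed (intro continuous_intros)+
    then have "S * q \<le> (\<integral>\<omega>. Y \<omega> * exp (S * Y \<omega>) \<partial>\<Omega>)" by (simp add: q_def)
    then have "lam * (S * q) \<le> g S"
      unfolding g_def using \<open>lam > 0\<close> by (intro mult_left_mono) auto
    moreover have "lam * (S * q) = \<bar>v\<bar>" using \<open>0 < q\<close> \<open>lam > 0\<close> by (simp add: S_def)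
    ultimately have "v \<le> g S" by simp
    have "continuous_on UNIV g"
      unfolding g_def
      by (intro continuous_on_mult_left
           continuous_expectation_exp[OF \<open>prob_space \<Omega>\<close> Y Y_bounds, of "\<lambda>z. z"] continuous_intros)
    then have "continuous_on {0..S} g" by (rule continuous_on_subset) simp
    then obtain s where s: "0 \<le> s" "s \<le> S" "g s = v"
      using IVT'[of g 0 v S] False \<open>v \<le> g S\<close> \<open>0 \<le> S\<close> by auto
    have "s \<noteq> 0" using s(3) False by auto
    then have "v * s < lam * (M s - 1) + 1" using s by (intro sub) auto
    then show thesis
      by (intro that[of s]) (use s pos in \<open>auto simp: mult.commute\<close>)
  qed
qed

text \<open>
  If every truncation level \<open>n\<close> failed, the sets \<open>K n\<close> of rates \<open>\<zeta>\<close> that witness the failure would be nonempty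
  and, since the truncated moment generating functions increase with \<open>n\<close>, decreasing. They are compact
  because the quadratic term of the exponential series confines the rates to a fixed interval.
  A common rate \<open>\<zeta>\<close> is positive, and by Fatou's lemma the inequality passes to the untruncated
  transform. Then \<open>\<zeta>\<close> shows both that the abscissa is positive and that the critical speed is at most
  \<open>v\<close>, a contradiction; this covers an abscissa of zero, too. The truncation levels start at one
  so that \<open>Y n\<close> is almost surely positive.
\<close>

lemma truncation_keeps_speed:
  fixes \<Omega> :: "'w measure" and Z :: "'w \<Rightarrow> real" and lam v :: real
  defines "Y \<equiv> \<lambda>n \<omega>. max 0 (min (Z \<omega>) (real (Suc n)))"
  assumes "lam > 0" "prob_space \<Omega>" and Z[measurable]: "Z \<in> borel_measurable \<Omega>"
    and Z_pos: "AE \<omega> in \<Omega>. Z \<omega> > 0" and J: "J = cdf (distr \<Omega> borel Z)"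
    and v: "ereal v < critical_speed lam J"
  obtains n where "\<And>\<zeta>. 0 < \<zeta> \<Longrightarrow> v * \<zeta> < lam * ((\<integral>\<omega>. exp (\<zeta> * Y n \<omega>) \<partial>\<Omega>) - 1) + 1"
proof (rule ccontr)
  assume neg: "\<not> thesis"
  interpret P: prob_space \<Omega> by fact
  have Ym[measurable]: "Y n \<in> borel_measurable \<Omega>" for n unfolding Y_def by measurable
  have Y_bounds: "0 \<le> Y n \<omega> \<and> Y n \<omega> \<le> real (Suc n)" for n \<omega> by (auto simp: Y_def)
  note int = integrable_continuous_of_bounded[OF \<open>prob_space \<Omega>\<close> Ym Y_bounds]
  define M where "M = (\<lambda>n \<zeta>. \<integral>\<omega>. exp (\<zeta> * Y n \<omega>) \<partial>\<Omega>)"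
  have int_exp: "integrable \<Omega> (\<lambda>\<omega>. exp (\<zeta> * Y n \<omega>))" for n \<zeta>
    by (rule int) (intro continuous_intros)
  have M_mono: "M m \<zeta> \<le> M n \<zeta>" if "m \<le> n" "0 \<le> \<zeta>" for m n \<zeta>
    unfolding M_def
  proof (rule integral_mono[OF int_exp int_exp])
    have "Y m \<omega> \<le> Y n \<omega>" for \<omega> using that(1) by (auto simp: Y_def)
    then show "exp (\<zeta> * Y m \<omega>) \<le> exp (\<zeta> * Y n \<omega>)" for \<omega>
      using that(2) by (simp add: mult_left_mono)
  qed
  have fails: "\<exists>\<zeta>>0. lam * (M n \<zeta> - 1) + 1 \<le> v * \<zeta>" for n
    using neg that[of n] unfolding M_def by (meson not_le)
  define q where "q = (\<integral>\<omega>. (Y 0 \<omega>)\<^sup>2 \<partial>\<Omega>)"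
  have "0 < q"
    unfolding q_def
  proof (rule P.expectation_pos)
    show "integrable \<Omega> (\<lambda>\<omega>. (Y 0 \<omega>)\<^sup>2)" by (rule int) (intro continuous_intros)
    show "AE \<omega> in \<Omega>. 0 < (Y 0 \<omega>)\<^sup>2" using Z_pos by eventually_elim (simp add: Y_def)
  qed
  have M_ge: "1 + \<zeta>\<^sup>2 / 2 * q \<le> M 0 \<zeta>" if "0 \<le> \<zeta>" for \<zeta>
  proof -
    have i: "integrable \<Omega> (\<lambda>\<omega>. \<zeta>\<^sup>2 / 2 * (Y 0 \<omega>)\<^sup>2)" by (rule int) (intro continuous_intros; simp)
    have "1 + \<zeta>\<^sup>2 / 2 * q = (\<integral>\<omega>. 1 + \<zeta>\<^sup>2 / 2 * (Y 0 \<omega>)\<^sup>2 \<partial>\<Omega>)"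
      using i by (simp add: q_def P.prob_space)
    also have "\<dots> \<le> M 0 \<zeta>"
      unfolding M_def
    proof (rule integral_mono[OF _ int_exp])
      show "1 + \<zeta>\<^sup>2 / 2 * (Y 0 \<omega>)\<^sup>2 \<le> exp (\<zeta> * Y 0 \<omega>)" for \<omega>
      proof -
        have "0 \<le> \<zeta> * Y 0 \<omega>" using that Y_bounds[of 0 \<omega>] by simp
        then show ?thesis
          using exp_lower_Taylor_quadratic[of "\<zeta> * Y 0 \<omega>"] by (simp add: power_mult_distrib)
      qed
    qed (use i in auto)
    finally show ?thesis .
  qed
  \<comment> \<open>Solves \<open>lam B\<^sup>2 q / 2 = v B\<close>: larger rates are excluded by the quadratic lower bound for \<open>M 0\<close>.\<close>
  define B where "B = 2 * v / (lam * q)"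
  define K where "K = (\<lambda>n. {\<zeta> \<in> {0..B}. lam * (M n \<zeta> - 1) + 1 \<le> v * \<zeta>})"
  have "\<Inter>(range K) \<noteq> {}"
  proof (rule compact_nest)
    fix n
    have "continuous_on UNIV (M n)"
      using continuous_expectation_exp[OF \<open>prob_space \<Omega>\<close> Ym Y_bounds, of "\<lambda>_. 1" n] by (simp add: M_def)
    then have "closed {\<zeta>. lam * (M n \<zeta> - 1) + 1 \<le> v * \<zeta>}"
      by (intro closed_Collect_le continuous_intros) auto
    moreover have "K n = {0..B} \<inter> {\<zeta>. lam * (M n \<zeta> - 1) + 1 \<le> v * \<zeta>}"
      by (auto simp: K_def)
    ultimately show "compact (K n)" by (simp add: compact_Int_closed)
    obtain \<zeta> where \<zeta>: "0 < \<zeta>" "lam * (M n \<zeta> - 1) + 1 \<le> v * \<zeta>"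
      using fails by blast
    have "lam * (\<zeta>\<^sup>2 / 2 * q) \<le> lam * (M n \<zeta> - 1)"
      using M_ge[of \<zeta>] M_mono[of 0 n \<zeta>] \<zeta>(1) \<open>lam > 0\<close> by (intro mult_left_mono) auto
    then have "\<zeta> * (\<zeta> * (lam * q)) \<le> \<zeta> * (2 * v)"
      using \<zeta>(2) by (simp add: power2_eq_square algebra_simps)
    then have "\<zeta> * (lam * q) \<le> 2 * v" using \<zeta>(1) by (rule mult_left_le_imp_le)
    then have "\<zeta> \<le> B" using \<open>0 < q\<close> \<open>lam > 0\<close> by (simp add: B_def pos_le_divide_eq)
    then show "K n \<noteq> {}" using \<zeta> by (auto simp: K_def)
  next
    fix m n :: nat assume "m \<le> n"
    show "K n \<subseteq> K m"
    proof
      fix \<zeta> assume \<zeta>: "\<zeta> \<in> K n"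
      then have "lam * (M m \<zeta> - 1) \<le> lam * (M n \<zeta> - 1)"
        using M_mono[OF \<open>m \<le> n\<close>, of \<zeta>] \<open>lam > 0\<close> by (intro mult_left_mono) (auto simp: K_def)
      then show "\<zeta> \<in> K m" using \<zeta> by (auto simp: K_def)
    qed
  qed
  then obtain \<zeta> where \<zeta>: "\<And>n. \<zeta> \<in> K n" by blast
  have M1: "1 \<le> M n \<zeta>" for n
    using M_ge[of \<zeta>] M_mono[of 0 n \<zeta>] \<zeta>[of 0] \<open>0 < q\<close> by (auto simp: K_def intro: order_trans[rotated])
  have "lam * 0 \<le> lam * (M 0 \<zeta> - 1)" using M1[of 0] \<open>lam > 0\<close> by (intro mult_left_mono) auto
  then have "0 < v * \<zeta>" using \<zeta>[of 0] by (auto simp: K_def)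
  then have "0 < \<zeta>" using \<zeta>[of 0] by (auto simp: K_def less_le)
  define R where "R = (v * \<zeta> - 1) / lam + 1"
  have M_le: "M n \<zeta> \<le> R" for n
    using \<zeta>[of n] \<open>lam > 0\<close> by (simp add: K_def R_def field_simps)
  have "0 \<le> R" using M1[of 0] M_le[of 0] by simp
  have dist: "interval_measure J = distr \<Omega> borel Z"
    unfolding J by (rule interval_measure_cdf) (rule P.real_distribution_distr, measurable)
  have "laplace_transform J (- \<zeta>) = (\<integral>\<^sup>+\<omega>. ennreal (exp (\<zeta> * Z \<omega>)) * indicator {0..} (Z \<omega>) \<partial>\<Omega>)"
    unfolding laplace_transform_def dist by (subst nn_integral_distr) auto
  also have "\<dots> \<le> (\<integral>\<^sup>+\<omega>. liminf (\<lambda>n. ennreal (exp (\<zeta> * Y n \<omega>))) \<partial>\<Omega>)"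
  proof (rule nn_integral_mono_AE)
    show "AE \<omega> in \<Omega>. ennreal (exp (\<zeta> * Z \<omega>)) * indicator {0..} (Z \<omega>)
        \<le> liminf (\<lambda>n. ennreal (exp (\<zeta> * Y n \<omega>)))"
      using Z_pos
    proof eventually_elim
      case (elim \<omega>)
      have "Y n \<omega> = Z \<omega>" if "nat \<lceil>Z \<omega>\<rceil> \<le> n" for n
        using that elim by (auto simp: Y_def)
      then have "\<forall>\<^sub>F n in sequentially. ennreal (exp (\<zeta> * Z \<omega>)) \<le> ennreal (exp (\<zeta> * Y n \<omega>))"
        by (intro eventually_sequentiallyI[of "nat \<lceil>Z \<omega>\<rceil>"]) auto
      then have "ennreal (exp (\<zeta> * Z \<omega>)) \<le> liminf (\<lambda>n. ennreal (exp (\<zeta> * Y n \<omega>)))"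
        by (rule Liminf_bounded)
      then show ?case using elim by (simp add: indicator_def)
    qed
  qed
  also have "\<dots> \<le> liminf (\<lambda>n. \<integral>\<^sup>+\<omega>. ennreal (exp (\<zeta> * Y n \<omega>)) \<partial>\<Omega>)"
    by (rule nn_integral_liminf) measurable
  also have "\<dots> = liminf (\<lambda>n. ennreal (M n \<zeta>))"
    unfolding M_def by (subst nn_integral_eq_integral[OF int_exp]) auto
  also have "\<dots> \<le> ennreal R"
    using M_le by (intro Liminf_le always_eventually) (auto intro!: ennreal_leI)
  finally have L: "laplace_transform J (- \<zeta>) \<le> ennreal R" .
  then have L_fin: "laplace_transform J (- \<zeta>) < \<infinity>"
    using ennreal_less_top[of R] by (auto intro: order.strict_trans1)
  have "enn2real (laplace_transform J (- \<zeta>)) \<le> R"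
    using enn2real_mono[OF L] \<open>0 \<le> R\<close> by simp
  then have "lam * enn2real (laplace_transform J (- \<zeta>)) \<le> lam * R"
    using \<open>lam > 0\<close> by simp
  also have "lam * R = v * \<zeta> - 1 + lam" using \<open>lam > 0\<close> by (simp add: R_def field_simps)
  finally have "lam * enn2real (laplace_transform J (- \<zeta>)) - lam + 1 \<le> v * \<zeta>" by simp
  then have "1 / \<zeta> * (lam * enn2real (laplace_transform J (- \<zeta>)) - lam + 1) \<le> v"
    using \<open>0 < \<zeta>\<close> by (simp add: pos_divide_le_eq)
  then have speed: "speed_fun lam J \<zeta> \<le> ereal v"
    using L_fin by (simp add: speed_fun_def)
  have "ereal \<zeta> \<le> abscissa J"
    unfolding abscissa_def by (rule Sup_upper) (use \<open>0 < \<zeta>\<close> L_fin in auto)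
  then have "0 < abscissa J" using \<open>0 < \<zeta>\<close> by (auto intro: less_le_trans[of _ "ereal \<zeta>"])
  then have "critical_speed lam J \<le> speed_fun lam J \<zeta>"
    unfolding critical_speed_def using \<open>0 < \<zeta>\<close> by (auto intro: INF_lower)
  with speed v show False by (meson leD order_trans)
qed

section \<open>Spreading and saturation\<close>

text \<open>
  While \<open>g\<close> lies between \<open>\<delta>\<close> and \<open>1 - \<epsilon>\<close> it decreases at a rate of at least \<open>\<epsilon> \<delta>\<close>; staying there for
  time \<open>1 / (\<epsilon> \<delta>)\<close> would cost more than the available range.
\<close>

lemma logistic_decay:
  fixes g :: "real \<Rightarrow> real"
  assumes "0 \<le> t0" "0 < \<epsilon>" "0 < \<delta>"
    and anti: "antimono_on {0..} g" and Lip: "L-lipschitz_on {0..} g"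
    and g_nonneg: "\<And>t. 0 \<le> t \<Longrightarrow> 0 \<le> g t"
    and deriv: "\<And>t D. 0 < t \<Longrightarrow> (g has_real_derivative D) (at t) \<Longrightarrow> D \<le> - g t * (1 - g t)"
    and start: "g t0 \<le> 1 - \<epsilon>"
  shows "g (t0 + 1 / (\<epsilon> * \<delta>)) \<le> \<delta>"
proof (rule ccontr)
  define \<tau> where "\<tau> = 1 / (\<epsilon> * \<delta>)"
  have "0 < \<tau>" using assms by (simp add: \<tau>_def)
  assume "\<not> g (t0 + 1 / (\<epsilon> * \<delta>)) \<le> \<delta>"
  then have "\<delta> < g (t0 + \<tau>)" by (simp add: \<tau>_def)
  have "g (t0 + \<tau>) - g t0 \<le> - (\<delta> * \<epsilon>) * ((t0 + \<tau>) - t0)"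
  proof (rule Lipschitz_increment_le[where N = "{}"])
    show "L-lipschitz_on {t0..t0 + \<tau>} g"
      by (rule lipschitz_on_subset[OF Lip]) (use \<open>0 \<le> t0\<close> in auto)
    fix t D assume t: "t \<in> {t0<..<t0 + \<tau>} - {}" and D: "(g has_real_derivative D) (at t)"
    have "\<delta> \<le> g t"
      using monotone_onD[OF anti, of t "t0 + \<tau>"] t \<open>0 \<le> t0\<close> \<open>\<delta> < g (t0 + \<tau>)\<close> by auto
    moreover have "\<epsilon> \<le> 1 - g t"
      using monotone_onD[OF anti, of t0 t] t \<open>0 \<le> t0\<close> start by auto
    ultimately have "\<delta> * \<epsilon> \<le> g t * (1 - g t)"
      using assms by (intro mult_mono) auto
    then show "D \<le> - (\<delta> * \<epsilon>)" using deriv[of t D] D t \<open>0 \<le> t0\<close> by auto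
  qed (use \<open>0 < \<tau>\<close> in auto)
  also have "\<dots> = - 1" using assms by (simp add: \<tau>_def)
  finally have "g (t0 + \<tau>) \<le> - \<epsilon>" using start by simp
  then show False using g_nonneg[of "t0 + \<tau>"] \<open>0 \<le> t0\<close> \<open>0 < \<tau>\<close> \<open>0 < \<epsilon>\<close> by simp
qed

text \<open>
  The speed \<open>v\<close> is first raised slightly to \<open>v'\<close>. The group velocity found for \<open>v'\<close> is then strictly
  above \<open>v\<close>, which leaves room for the loss of speed in the construction of the subsolution.
\<close>

lemma linear_spreading:
  assumes "lam > 0" "prob_space \<Omega>" and Z[measurable]: "Z \<in> borel_measurable \<Omega>"
    and Z_pos: "AE \<omega> in \<Omega>. Z \<omega> > 0" and J: "J = cdf (distr \<Omega> borel Z)"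
    and mfl: "mean_field_limit lam J f0 f" and v: "ereal v < critical_speed lam J"
  obtains \<epsilon> c X where "0 < \<epsilon>" "v < c" "\<forall>t\<ge>0. \<forall>x\<le>X + c * t. f t x \<le> 1 - \<epsilon>"
proof -
  have "\<exists>v'. v < v' \<and> ereal v' < critical_speed lam J"
    using ereal_dense2[OF v] by auto
  then obtain v' where v': "v < v'" "ereal v' < critical_speed lam J" by blast
  obtain n where n: "\<And>\<zeta>. 0 < \<zeta> \<Longrightarrow>
      v' * \<zeta> < lam * ((\<integral>\<omega>. exp (\<zeta> * max 0 (min (Z \<omega>) (real (Suc n)))) \<partial>\<Omega>) - 1) + 1"
    by (rule truncation_keeps_speed[OF \<open>lam > 0\<close> \<open>prob_space \<Omega>\<close> Z Z_pos J v'(2)]) blast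
  define C where "C = real (Suc n)"
  define Y where "Y = (\<lambda>\<omega>. max 0 (min (Z \<omega>) C))"
  have "C > 0" by (simp add: C_def)
  have Y[measurable]: "Y \<in> borel_measurable \<Omega>" unfolding Y_def by measurable
  have Y_bounds: "0 \<le> Y \<omega> \<and> Y \<omega> \<le> C" for \<omega> using \<open>C > 0\<close> by (auto simp: Y_def)
  have Y_pos: "AE \<omega> in \<Omega>. 0 < Y \<omega>" using Z_pos by eventually_elim (use \<open>C > 0\<close> in \<open>simp add: Y_def\<close>)
  have YZ: "AE \<omega> in \<Omega>. Y \<omega> \<le> Z \<omega>" using Z_pos by eventually_elim (simp add: Y_def)
  obtain s where s: "0 \<le> s" "0 < lam * (\<integral>\<omega>. Y \<omega> * exp (s * Y \<omega>) \<partial>\<Omega>)"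
     "v' \<le> lam * (\<integral>\<omega>. Y \<omega> * exp (s * Y \<omega>) \<partial>\<Omega>)"
     "0 < lam * ((\<integral>\<omega>. exp (s * Y \<omega>) \<partial>\<Omega>) - 1) + 1 - s * (lam * (\<integral>\<omega>. Y \<omega> * exp (s * Y \<omega>) \<partial>\<Omega>))"
    by (rule exists_decay_rate_of_speed[OF \<open>lam > 0\<close> \<open>prob_space \<Omega>\<close> Y Y_bounds Y_pos, of v'])
       (use n in \<open>auto simp: Y_def C_def\<close>)
  have "v < lam * (\<integral>\<omega>. Y \<omega> * exp (s * Y \<omega>) \<partial>\<Omega>)" using v'(1) s(3) by simp
  then obtain \<epsilon> c w B y0 where w:
    "0 < \<epsilon>" "\<epsilon> < 1" "0 < c" "v < c" "travelling_subsolution lam \<Omega> Y c w"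
    and w_le: "\<forall>y. w y \<le> \<epsilon>" and w_zero: "\<forall>y\<ge>B. w y = 0" and w_top: "\<forall>y\<le>y0. w y = \<epsilon>"
    by (rule travelling_subsolution_exists[OF \<open>prob_space \<Omega>\<close> Y Y_bounds \<open>lam > 0\<close> s(1,2) _ s(4)])
  have proper: "f t \<in> proper_cdfs" if "0 \<le> t" for t
    using mfl that by (simp add: mean_field_limit_def)
  note f_bounds = proper_cdfsD(1,2)[OF proper]
  note deriv = mean_field_limit_derivative_le[OF \<open>lam > 0\<close> \<open>prob_space \<Omega>\<close> Z Z_pos J mfl Y _ YZ]
  have "\<forall>\<^sub>F x in at_bot. f 0 x < 1 - \<epsilon>"
    using proper_cdfsD(4)[OF proper[of 0]] \<open>\<epsilon> < 1\<close> by (intro order_tendstoD) auto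
  then obtain x0 where x0: "\<And>x. x \<le> x0 \<Longrightarrow> f 0 x < 1 - \<epsilon>"
    by (auto simp: eventually_at_bot_linorder)
  \<comment> \<open>Shifts the point \<open>B\<close> where the profile vanishes to \<open>x0\<close>, left of which the initial tail exceeds \<open>\<epsilon>\<close>.\<close>
  define X where "X = x0 - B"
  have below: "w (x - c * t) \<le> 1 - f t (x + X)" if "0 \<le> t" for t x
  proof (rule travelling_subsolution_stays_below[OF \<open>lam > 0\<close> \<open>prob_space \<Omega>\<close> Y, where f = "\<lambda>t x. f t (x + X)"])
    show "mono (\<lambda>x. f t (x + X))" if "0 \<le> t" for t
      using proper_cdfsD(3)[OF proper[OF that]] by (auto simp: mono_def)
    show "(lam + 1)-lipschitz_on {0..} (\<lambda>t. f t (x + X))" for x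
      using mfl by (simp add: mean_field_limit_def)
    show "D \<le> - lam * (\<integral>\<omega>. f t (x + X) - f t (x - Y \<omega> + X) \<partial>\<Omega>) - f t (x + X) * (1 - f t (x + X))"
      if "0 < t" "((\<lambda>s. f s (x + X)) has_real_derivative D) (at t)" for t x D
      using deriv(1)[OF _ that] Y_bounds by (simp add: algebra_simps)
    show "D \<le> 0" if "0 < t" "((\<lambda>s. f s (x + X)) has_real_derivative D) (at t)" for t x D
    proof -
      have "0 \<le> f t (x + X) * (1 - f t (x + X))" using f_bounds[of t "x + X"] that(1) by simp
      then show ?thesis using deriv(2)[OF _ that] Y_bounds by simp
    qed
    show "w x \<le> 1 - f 0 (x + X)" for x
    proof (cases "B \<le> x")
      case True
      then show ?thesis using w_zero f_bounds[of 0 "x + X"] by simp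
    next
      case False
      then have "f 0 (x + X) < 1 - \<epsilon>" by (intro x0) (simp add: X_def)
      then show ?thesis using w_le[rule_format, of x] by simp
    qed
  qed (use f_bounds w \<open>0 \<le> t\<close> in auto)
  have "f t x \<le> 1 - \<epsilon>" if "0 \<le> t" "x \<le> (X + y0) + c * t" for t x
    using below[OF that(1), of "x - X"] w_top[rule_format, of "x - X - c * t"] that(2) by simp
  then show thesis using w(1,4) that by blast
qed

theorem theorem12:
  fixes lam :: real
    and \<Omega> :: "'w measure" and Z :: "'w \<Rightarrow> real" and J :: "real \<Rightarrow> real"
    and f0 :: "real \<Rightarrow> real" and f :: "real \<Rightarrow> real \<Rightarrow> real"
  assumes "lam > 0"
    and "prob_space \<Omega>"
    and "Z \<in> borel_measurable \<Omega>"
    and "AE \<omega> in \<Omega>. Z \<omega> > 0"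
    and "integrable \<Omega> Z" and "prob_space.expectation \<Omega> Z = 1"
    and "J = cdf (distr \<Omega> borel Z)"
    and "f0 \<in> proper_cdfs"
    and "mean_field_limit lam J f0 f"
  shows "avg_speed_lower_bounded f (critical_speed lam J)"
  unfolding avg_speed_lower_bounded_def
proof (rule ballI, rule dense_le)
  fix \<nu> :: real and u :: ereal
  assume \<nu>: "\<nu> \<in> {0<..<1}" and u: "u < critical_speed lam J"
  let ?q = "\<lambda>t. quantile \<nu> (f t)"
  let ?r = "\<lambda>t. ereal ((?q t - ?q 0) / t)"
  have mfl: "mean_field_limit lam J f0 f" by fact
  have main: "ereal v \<le> Liminf at_top ?r" if v: "ereal v < critical_speed lam J" for v
  proof -
    obtain \<epsilon> c X where sp: "0 < \<epsilon>" "v < c" "\<forall>t\<ge>0. \<forall>x\<le>X + c * t. f t x \<le> 1 - \<epsilon>"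
      by (rule linear_spreading[OF assms(1-4,7) mfl v])
    \<comment> \<open>The time in which \<open>f\<close> drops from \<open>1 - \<epsilon>\<close> to \<open>\<nu> / 2\<close>, a level strictly below \<open>\<nu>\<close>.\<close>
    define \<tau> where "\<tau> = 1 / (\<epsilon> * (\<nu> / 2))"
    have "0 < \<tau>" using sp \<nu> by (simp add: \<tau>_def)
    have quant: "X + c * (t - \<tau>) \<le> ?q t" if "\<tau> \<le> t" for t
    proof -
      have "0 \<le> t" using that \<open>0 < \<tau>\<close> by simp
      then have proper: "f t \<in> proper_cdfs" using mfl by (simp add: mean_field_limit_def)
      have small: "f t x \<le> \<nu> / 2" if "x \<le> X + c * (t - \<tau>)" for x
      proof -
        have "f ((t - \<tau>) + 1 / (\<epsilon> * (\<nu> / 2))) x \<le> \<nu> / 2"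
        proof (rule logistic_decay[where g = "\<lambda>t. f t x" and L = "lam + 1"])
          show "antimono_on {0..} (\<lambda>t. f t x)" "(lam + 1)-lipschitz_on {0..} (\<lambda>t. f t x)"
            using mfl by (auto simp: mean_field_limit_def)
          show "f (t - \<tau>) x \<le> 1 - \<epsilon>" using sp(3) that \<open>\<tau> \<le> t\<close> by auto
          show "0 \<le> f t x" if "0 \<le> t" for t
            using mfl that by (intro proper_cdfsD(1)) (simp add: mean_field_limit_def)
          show "D \<le> - f t x * (1 - f t x)" if "0 < t" "((\<lambda>t. f t x) has_real_derivative D) (at t)" for t D
            by (rule mean_field_limit_derivative_le(2)[OF assms(1-4,7) mfl _ _ _ that, of "\<lambda>_. 0"])
               (use assms(4) in \<open>auto elim: eventually_mono\<close>)
        qed (use sp \<nu> \<open>\<tau> \<le> t\<close> in auto)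
        then show ?thesis by (simp add: \<tau>_def)
      qed
      have "\<forall>\<^sub>F x in at_top. \<nu> < f t x"
        using proper_cdfsD(5)[OF proper] \<nu> by (intro order_tendstoD) auto
      then obtain y where "\<nu> \<le> f t y" unfolding eventually_at_top_linorder by (meson less_imp_le order_refl)
      then have ne: "{y. \<nu> \<le> f t y} \<noteq> {}" by blast
      show ?thesis
        unfolding quantile_def
      proof (rule cInf_greatest[OF ne])
        fix y assume "y \<in> {y. \<nu> \<le> f t y}"
        then have "\<not> f t y \<le> \<nu> / 2" using \<nu> by auto
        then show "X + c * (t - \<tau>) \<le> y" using small[of y] by linarith
      qed
    qed
    show ?thesis
    proof (rule Liminf_bounded)
      show "\<forall>\<^sub>F t in at_top. ereal v \<le> ?r t"
      proof (rule eventually_at_top_linorderI)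
        fix t assume t: "max (max 1 \<tau>) ((?q 0 + c * \<tau> - X) / (c - v)) \<le> t"
        then have "(?q 0 + c * \<tau> - X) / (c - v) \<le> t" "1 \<le> t" "\<tau> \<le> t" by auto
        then have "?q 0 + c * \<tau> - X \<le> t * (c - v)"
          using sp(2) by (simp add: pos_divide_le_eq)
        then have "v * t \<le> ?q t - ?q 0"
          using quant[OF \<open>\<tau> \<le> t\<close>] by (simp add: algebra_simps)
        then show "ereal v \<le> ?r t"
          using \<open>1 \<le> t\<close> by (simp add: pos_le_divide_eq)
      qed
    qed
  qed
  show "u \<le> Liminf at_top ?r"
    using main u by (cases u) auto
qed

end
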